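(* Suppose the system $$\frac{\partial U}{\partial t}+\sum_{j=1}^d A_j\frac{\partial U}{\partial x_j}=\frac1\varepsilon QU,\qquad U(0,x,\varepsilon^{-1})=U_0(x),$$ is stiffly well-posed. Then the reduced system $$\frac{\partial \breve u}{\partial t}+\sum_{j=1}^d A_{j,11}\frac{\partial \breve u}{\partial x_j}=0,\qquad \breve u(0,x)=u_0(x),$$ is strongly hyperbolic, and for each $t>0$ and each $U_0\in L^2$, $$\lim_{\varepsilon\to0}\|u(t,\cdot,\varepsilon^{-1})-\breve u(t,\cdot)\|_{L^2}=0 .$$ Furthermore, if the matrix set $\mathcal F_2=\{H_{22}(\xi,\eta): \xi\in\mathbb R^d,\ \eta\ge0\}$ is uniformly quasi-stable, then there is a constant $C$, depending on the matrices $A_j$ and $Q$, such that for each $t>0$, each $U_0\in H^2$ and all sufficiently small $\varepsilon>0$, $$\|u(t,\cdot,\varepsilon^{-1})-\breve u(t,\cdot)\|_{L^2}\le C e^t\,\varepsilon\,|\log\varepsilon|\,\|U_0\|_{H^2}.$$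
   Context: Here $Q\in\mathbb R^{n\times n}$ and $A_j\in\mathbb R^{n\times n}$ ($j=1,\dots,d$) are constant matrices, $\varepsilon>0$, $\eta=\varepsilon^{-1}$, and $U$ is an $n$-vector function of $(t,x,\eta)$ with $t\ge 0$, $x\in\mathbb R^d$. For $\xi\in\mathbb R^d$, $\eta\ge0$ put $$H(\xi,\eta)=\eta Q-i\sum_{j=1}^d\xi_jA_j .$$ A set $\mathcal F$ of complex square matrices of a fixed size is uniformly quasi-stable if $\sup_{M\in\mathcal F}\sup_{t\ge0}\|e^{Mt}\|<+\infty$; a single matrix $M$ is quasi-stable if $\{M\}$ is. The system is stiffly well-posed if $\mathcal F_0=\{H(\xi,\eta):\xi\in\mathbb R^d,\eta\ge0\}$ is uniformly quasi-stable. A system $\partial_tW+\sum_jC_j\partial_{x_j}W=0$ is strongly hyperbolic if $\{-i\sum_j\xi_jC_j:\xi\in\mathbb R^d\}$ is uniformly quasi-stable. Block form convention: stiff well-posedness implies that $Q$ is quasi-stable, so $0$ is a semi-simple eigenvalue of $Q$ (if it is an eigenvalue) and after a linear change of unknowns $U\mapsto PU$ (replacing $A_j,Q$ by $PA_jP^{-1},PQP^{-1}$) the matrix $Q$ is block diagonal. The system is always taken to be written in such unknowns: $$Q=\begin{pmatrix} 0 & 0 \\ 0 & B \end{pmatrix},\quad A_j=\begin{pmatrix} A_{j,11} & A_{j,12} \\ A_{j,21} & A_{j,22} \end{pmatrix},\quad H=\begin{pmatrix} H_{11} & H_{12} \\ H_{21} & H_{22} \end{pmatrix},\quad U=\begin{pmatrix}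 u \\ v \end{pmatrix},\quad U_0=\begin{pmatrix} u_0 \\ v_0 \end{pmatrix},$$ with $B$ an invertible $r\times r$ matrix and blocks of sizes $n-r$ and $r$. Thus $H_{22}(\xi,\eta)=\eta B-i\sum_j\xi_jA_{j,22}$; $u$ are the slow variables and $v$ the fast variables. Solutions are understood through the Fourier transform in $x$: $\hat U(t,\xi,\eta)=\exp(tH(\xi,\eta))\hat U_0(\xi)$, and $\hat{\breve u}(t,\xi)=\exp\big(-it\sum_j\xi_jA_{j,11}\big)\hat u_0(\xi)$. $L^2$ and $H^2$ are the usual (vector-valued) spaces on $\mathbb R^d$. *)

theory Defs
  imports "HOL-Analysis.Analysis"
begin

text \<open>The index type \<open>'m + 'r\<close> splits the unknowns into slow ones (\<open>Inl\<close>, size \<open>n - r\<close>)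
  and fast ones (\<open>Inr\<close>, size \<open>r\<close>).\<close>

definition slow :: "'a^('m::finite + 'r::finite) \<Rightarrow> 'a^'m" where
  "slow w = (\<chi> i. w $ Inl i)"

definition block11 :: "'a^('m::finite + 'r::finite)^('m + 'r) \<Rightarrow> 'a^'m^'m" where
  "block11 M = (\<chi> i j. M $ Inl i $ Inl j)"

definition block12 :: "'a^('m::finite + 'r::finite)^('m + 'r) \<Rightarrow> 'a^'r^'m" where
  "block12 M = (\<chi> i j. M $ Inl i $ Inr j)"

definition block21 :: "'a^('m::finite + 'r::finite)^('m + 'r) \<Rightarrow> 'a^'m^'r" where
  "block21 M = (\<chi> i j. M $ Inr i $ Inl j)"

definition block22 :: "'a^('m::finite + 'r::finite)^('m + 'r) \<Rightarrow> 'a^'r^'r" where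
  "block22 M = (\<chi> i j. M $ Inr i $ Inr j)"

definition relaxation_block_form :: "real^('m::finite + 'r::finite)^('m + 'r) \<Rightarrow> bool" where
  "relaxation_block_form Q \<longleftrightarrow>
     block11 Q = 0 \<and> block12 Q = 0 \<and> block21 Q = 0 \<and> invertible (block22 Q)"

text \<open>The library multiplication \<open>*\<close> on the vector type is componentwise, so the library
  \<open>exp\<close> does not provide the matrix exponential.\<close>

definition matpow :: "complex^'n^'n \<Rightarrow> nat \<Rightarrow> complex^'n^'n" where
  "matpow M k = (((**) M) ^^ k) (mat 1)"

definition matexp :: "complex^'n^'n \<Rightarrow> complex^'n^'n" where
  "matexp M = (\<Sum>k. (1 / fact k) *\<^sub>R matpow M k)"

definition uniformly_quasi_stable :: "(complex^'n^'n) set \<Rightarrow> bool" where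
  "uniformly_quasi_stable F \<longleftrightarrow>
     bdd_above {onorm ((*v) (matexp (t *\<^sub>R M))) | M t. M \<in> F \<and> t \<ge> 0}"

definition flux_symbol :: "('d::finite \<Rightarrow> real^'n^'n) \<Rightarrow> real^'d \<Rightarrow> complex^'n^'n" where
  "flux_symbol C \<xi> = map_matrix (\<lambda>c. - \<i> * complex_of_real c) (\<Sum>j\<in>UNIV. \<xi> $ j *\<^sub>R C j)"

definition H :: "('d::finite \<Rightarrow> real^'n^'n) \<Rightarrow> real^'n^'n \<Rightarrow> real^'d \<Rightarrow> real \<Rightarrow> complex^'n^'n" where
  "H A Q \<xi> \<eta> = map_matrix complex_of_real (\<eta> *\<^sub>R Q) + flux_symbol A \<xi>"

definition stiffly_well_posed :: "('d::finite \<Rightarrow> real^'n^'n) \<Rightarrow> real^'n^'n \<Rightarrow> bool" where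
  "stiffly_well_posed A Q \<longleftrightarrow> uniformly_quasi_stable {H A Q \<xi> \<eta> | \<xi> \<eta>. \<eta> \<ge> 0}"

definition strongly_hyperbolic :: "('d::finite \<Rightarrow> real^'n^'n) \<Rightarrow> bool" where
  "strongly_hyperbolic C \<longleftrightarrow> uniformly_quasi_stable (range (flux_symbol C))"

definition square_integrable :: "(real^'d \<Rightarrow> complex^'n) \<Rightarrow> bool" where
  "square_integrable f \<longleftrightarrow>
     f \<in> borel_measurable lborel \<and> integrable lborel (\<lambda>x. (norm (f x))\<^sup>2)"

definition L2norm :: "(real^'d \<Rightarrow> complex^'n) \<Rightarrow> real" where
  "L2norm f = sqrt (\<integral>x. (norm (f x))\<^sup>2 \<partial>lborel)"

text \<open>The Fourier transform on \<open>L\<^sup>2\<close> (unitary normalisation) is the \<open>L\<^sup>2\<close>-limit of the Fourier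
  integrals over growing balls.  It is rendered as a relation because it is determined only
  almost everywhere; the \<open>ennreal\<close>-valued integral avoids the default value 0 that the Bochner
  integral gives to non-integrable functions.\<close>

definition truncated_fourier :: "real \<Rightarrow> (real^'d \<Rightarrow> complex^'n) \<Rightarrow> real^'d \<Rightarrow> complex^'n" where
  "truncated_fourier R f \<xi> = ((2 * pi) powr (- real CARD('d) / 2)) *\<^sub>R
     (LINT x:cball 0 R|lborel. cis (- (\<xi> \<bullet> x)) *s f x)"

definition has_L2_fourier :: "(real^'d \<Rightarrow> complex^'n) \<Rightarrow> (real^'d \<Rightarrow> complex^'n) \<Rightarrow> bool" where
  "has_L2_fourier f g \<longleftrightarrow> square_integrable f \<and> square_integrable g \<and>
     ((\<lambda>R. \<integral>\<^sup>+ \<xi>. ennreal ((norm (truncated_fourier R f \<xi> - g \<xi>))\<^sup>2) \<partial>lborel)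
       \<longlongrightarrow> 0) at_top"

definition L2_fourier :: "(real^'d \<Rightarrow> complex^'n) \<Rightarrow> real^'d \<Rightarrow> complex^'n" where
  "L2_fourier f = (SOME g. has_L2_fourier f g)"

definition sobolev_weight :: "real \<Rightarrow> (real^'d \<Rightarrow> complex^'n) \<Rightarrow> real^'d \<Rightarrow> complex^'n" where
  "sobolev_weight s g \<xi> = ((1 + (norm \<xi>)\<^sup>2) powr (s / 2)) *\<^sub>R g \<xi>"

definition sobolev_space :: "real \<Rightarrow> (real^'d \<Rightarrow> complex^'n) set" where
  "sobolev_space s = {f. \<exists>g. has_L2_fourier f g \<and> square_integrable (sobolev_weight s g)}"

definition sobolev_norm :: "real \<Rightarrow> (real^'d \<Rightarrow> complex^'n) \<Rightarrow> real" where
  "sobolev_norm s f = L2norm (sobolev_weight s (L2_fourier f))"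

text \<open>\<open>W\<close> solves the Cauchy problem with spatial Fourier symbol \<open>P\<close> and data \<open>W0\<close>.
  By Plancherel and the boundedness of the propagator such a \<open>W\<close> exists for every
  square-integrable \<open>W0\<close> when the range of \<open>P\<close> is uniformly quasi-stable; each \<open>W t\<close> is unique up to
  null sets, so a statement about all solutions is a statement about the solution.\<close>

definition fourier_solution ::
  "(real^'d \<Rightarrow> complex^'n^'n) \<Rightarrow> (real^'d \<Rightarrow> complex^'n) \<Rightarrow> (real \<Rightarrow> real^'d \<Rightarrow> complex^'n) \<Rightarrow> bool"
where
  "fourier_solution P W0 W \<longleftrightarrow>
     (\<exists>g. has_L2_fourier W0 g \<and>
        (\<forall>t\<ge>0. has_L2_fourier (W t) (\<lambda>\<xi>. matexp (t *\<^sub>R P \<xi>) *v g \<xi>)))"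

end

theory Submission
  imports Defs "HOL-Probability.Probability"
begin

text \<open>\<open>T\<close> is found by asking that \<open>T Q\<close> reproduce the coupling
  \<open>slow (L U) - M (slow U)\<close> of the fast into the slow variables. This coupling sees
  only the fast part of \<open>U\<close>, where \<open>Q\<close> is invertible, so applying
  \<open>P\<close>, then \<open>L\<close>, then \<open>slow\<close> does it. The correction
  \<open>\<epsilon> T U\<close> is small at every time, including \<open>t = 0\<close>, so the fast
  motion is averaged out instead of being followed through an initial layer. The price is two
  applications of symbols that grow like the frequency, that is, two derivatives: hence the space
  \<open>H^2\<close> in the rate.

  The obstacle is a circularity: Duhamel's formula needs a bound for \<open>exp (t M)\<close>, which
  is what strong hyperbolicity asserts. The estimate therefore carries that bound as a parameter
  \<open>K\<close>, while its own constant is fixed before frequency, time and \<open>K\<close>.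

  Plancherel's inequality is proved for functions that are both integrable and square-integrable.
  Restrictions of a square-integrable function to balls are of this kind, and the defining limit of
  the transform carries the inequality over.\<close>

text \<open>Write \<open>U = exp (t H) U\<^sub>0\<close> at a fixed frequency \<open>\<xi>\<close> and \<open>u = slow U\<close>. With \<open>P\<close> the inverse of \<open>Q\<close> on
  the fast variables, \<open>L\<close> the flux symbol, \<open>M\<close> its slow block and \<open>T U = slow (L P U)\<close>, the corrected
  variable \<open>z = u - \<epsilon> T U\<close> satisfies \<open>z' = M z + \<epsilon> (M T U - T L U)\<close>: the stiff terms cancel. Duhamel's
  formula then bounds the error by \<open>\<epsilon> (1 + t) (1 + \<bar>\<xi>\<bar>\<^sup>2) \<bar>U\<^sub>0\<bar>\<close>, with a constant that depends only on
  bounds for the two propagators. A crude local bound for \<open>exp (t M)\<close> suffices to let \<open>\<epsilon>\<close> tend to \<open>0\<close> at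
  fixed \<open>\<xi>\<close>, which yields the uniform bound (strong hyperbolicity); after that the same estimate gives
  both dominated convergence and the rate. The passage back to physical space only needs the
  inequality \<open>\<parallel>f\<parallel> \<le> \<parallel>g\<parallel>\<close> in Plancherel's theorem, obtained from the autocorrelation of \<open>f\<close> and
  Gaussian summation.\<close>

section \<open>The matrix exponential\<close>

lemma has_vector_derivative_vecI:
  fixes f :: "real \<Rightarrow> 'a::real_normed_vector^'n"
  assumes "\<And>i. ((\<lambda>t. f t $ i) has_vector_derivative (D $ i)) (at x within S)"
  shows "(f has_vector_derivative D) (at x within S)"
  using assms unfolding has_vector_derivative_def has_derivative_within
  by (auto intro!: vec_tendstoI bounded_linear_scaleR_left)

text \<open>The sum over all entries of \<open>M\<close> dominates every row sum, so a single number
  serves for all rows in the induction and makes the growth in \<open>k\<close> geometric.\<close>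

lemma norm_matpow_entry:
  fixes M :: "complex^'n^'n"
  shows "norm (matpow M k $ i $ j) \<le> (\<Sum>i\<in>UNIV. \<Sum>j\<in>UNIV. norm (M $ i $ j)) ^ k"
proof (induction k arbitrary: i j)
  case 0
  show ?case by (simp add: matpow_def mat_def)
next
  case (Suc k)
  let ?a = "\<Sum>i\<in>UNIV. \<Sum>j\<in>UNIV. norm (M $ i $ j)"
  have "norm (matpow M (Suc k) $ i $ j) = norm (\<Sum>l\<in>UNIV. M $ i $ l * matpow M k $ l $ j)"
    by (simp add: matpow_def matrix_matrix_mult_def)
  also have "\<dots> \<le> (\<Sum>l\<in>UNIV. norm (M $ i $ l) * ?a ^ k)"
    by (rule sum_norm_le) (simp add: norm_mult mult_left_mono Suc)
  also have "\<dots> = (\<Sum>l\<in>UNIV. norm (M $ i $ l)) * ?a ^ k"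
    by (simp add: sum_distrib_right)
  also have "\<dots> \<le> ?a * ?a ^ k"
    by (intro mult_right_mono zero_le_power sum_nonneg
        member_le_sum[of i UNIV "\<lambda>i. \<Sum>j\<in>UNIV. norm (M $ i $ j)"]) (auto intro: sum_nonneg)
  finally show ?case by simp
qed

lemma matpow_scaleR:
  fixes M :: "complex^'n^'n"
  shows "matpow (t *\<^sub>R M) k = t ^ k *\<^sub>R matpow M k"
proof (induction k)
  case (Suc k)
  have "matpow (t *\<^sub>R M) (Suc k) = (t *\<^sub>R M) ** (t ^ k *\<^sub>R matpow M k)"
    using Suc by (simp add: matpow_def)
  also have "\<dots> = t ^ Suc k *\<^sub>R (M ** matpow M k)"
    by (simp add: matrix_matrix_mult_def vec_eq_iff scaleR_sum_right mult_ac)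
  finally show ?case by (simp add: matpow_def)
qed (simp add: matpow_def)

lemma matpow_commute: "matpow M k ** M = M ** matpow M k"
  by (induction k) (auto simp: matpow_def matrix_mul_assoc[symmetric])

lemma summable_matexp_entry:
  fixes M :: "complex^'n^'n"
  shows "summable (\<lambda>k. (matpow M k $ i $ j / fact k) * z ^ k)"
proof -
  define a where "a = (\<Sum>i\<in>UNIV. \<Sum>j\<in>UNIV. norm (M $ i $ j))"
  show ?thesis
  proof (rule summable_comparison_test'[OF summable_exp[of "a * norm z"]])
    fix k
    have "norm (matpow M k $ i $ j) \<le> a ^ k"
      unfolding a_def by (rule norm_matpow_entry)
    then have "norm (matpow M k $ i $ j) * norm z ^ k \<le> a ^ k * norm z ^ k"
      by (rule mult_right_mono) simp
    then show "norm (matpow M k $ i $ j / fact k * z ^ k) \<le> inverse (fact k) * (a * norm z) ^ k"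
      by (simp add: norm_mult norm_divide norm_power power_mult_distrib field_simps)
  qed
qed

text \<open>Read entrywise, the exponential is a scalar power series in \<open>t\<close>, so
  termwise differentiation and comparison of coefficients become available.\<close>

lemma matexp_entry:
  "matexp (t *\<^sub>R M) $ i $ j = (\<Sum>k. (matpow M k $ i $ j / fact k) * of_real t ^ k)"
proof -
  have "(\<lambda>n. \<Sum>k<n. (1 / fact k) *\<^sub>R matpow (t *\<^sub>R M) k) \<longlonglongrightarrow>
      (\<chi> i j. \<Sum>k. (matpow M k $ i $ j / fact k) * of_real t ^ k)"
  proof (intro vec_tendstoI)
    fix i j
    show "(\<lambda>n. (\<Sum>k<n. (1 / fact k) *\<^sub>R matpow (t *\<^sub>R M) k) $ i $ j) \<longlonglongrightarrow>
      (\<chi> i j. \<Sum>k. (matpow M k $ i $ j / fact k) * of_real t ^ k) $ i $ j"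
    proof -
      have "((1 / fact k) *\<^sub>R matpow (t *\<^sub>R M) k) $ i $ j = matpow M k $ i $ j / fact k * of_real t ^ k" for k
        unfolding matpow_scaleR vector_scaleR_component by (simp add: scaleR_conv_of_real)
      then show ?thesis
        using summable_LIMSEQ[OF summable_matexp_entry[of M i j "of_real t"]]
        by (simp del: vector_scaleR_component)
    qed
  qed
  then have "(\<lambda>k. (1 / fact k) *\<^sub>R matpow (t *\<^sub>R M) k) sums
      (\<chi> i j. \<Sum>k. (matpow M k $ i $ j / fact k) * of_real t ^ k)"
    by (simp add: sums_def)
  then show ?thesis
    by (simp add: matexp_def sums_unique[symmetric])
qed

lemma matexp_0: "matexp (0 :: complex^'n^'n) = mat 1"
proof -
  have "matexp (0 *\<^sub>R (0 :: complex^'n^'n)) $ i $ j = mat 1 $ i $ j" for i j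
    unfolding matexp_entry by (simp only: of_real_0 powser_zero) (simp add: matpow_def)
  then show ?thesis by (simp add: vec_eq_iff)
qed

text \<open>Termwise differentiation cancels one factor of the factorial and raises the matrix power
  by one; peeling the new factor \<open>M\<close> off on the left gives the product. The series is
  differentiated in a complex variable and then restricted to the real line.\<close>

lemma has_vector_derivative_matexp_entry:
  "((\<lambda>t. matexp (t *\<^sub>R M) $ i $ j) has_vector_derivative
     (M ** matexp (t *\<^sub>R M)) $ i $ j) (at t)"
proof -
  define c where "c k = matpow M k $ i $ j / fact k" for k
  have summ: "summable (\<lambda>k. c k * z ^ k)" for z
    unfolding c_def by (rule summable_matexp_entry)
  have d: "diffs c k = (\<Sum>l\<in>UNIV. M $ i $ l * (matpow M k $ l $ j / fact k))" for k
  proof -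
    have "diffs c k = matpow M (Suc k) $ i $ j / fact k"
      by (simp add: diffs_def c_def)
        (metis of_nat_Suc of_nat_neq_0)
    then show ?thesis
      by (simp add: matpow_def matrix_matrix_mult_def sum_divide_distrib)
  qed
  have "((\<lambda>z. \<Sum>k. c k * z ^ k) has_field_derivative (\<Sum>k. diffs c k * of_real t ^ k)) (at (of_real t))"
    by (rule termdiffs_strong_converges_everywhere[OF summ])
  moreover have "(\<Sum>k. diffs c k * of_real t ^ k) = (M ** matexp (t *\<^sub>R M)) $ i $ j"
  proof -
    have "(\<Sum>k. diffs c k * of_real t ^ k) =
        (\<Sum>k. \<Sum>l\<in>UNIV. M $ i $ l * (matpow M k $ l $ j / fact k * of_real t ^ k))"
      by (simp only: d sum_distrib_right mult.assoc)
    also have "\<dots> = (\<Sum>l\<in>UNIV. \<Sum>k. M $ i $ l * (matpow M k $ l $ j / fact k * of_real t ^ k))"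
      by (rule suminf_sum) (intro summable_mult summable_matexp_entry)
    also have "\<dots> = (\<Sum>l\<in>UNIV. M $ i $ l * matexp (t *\<^sub>R M) $ l $ j)"
      by (intro sum.cong refl) (simp only: matexp_entry suminf_mult[OF summable_matexp_entry])
    finally show ?thesis by (simp add: matrix_matrix_mult_def)
  qed
  ultimately have "((\<lambda>z. \<Sum>k. c k * z ^ k) has_field_derivative (M ** matexp (t *\<^sub>R M)) $ i $ j) (at (of_real t))"
    by simp
  then have "(((\<lambda>z. \<Sum>k. c k * z ^ k) \<circ> of_real) has_vector_derivative 1 * (M ** matexp (t *\<^sub>R M)) $ i $ j) (at t)"
    by (intro field_vector_diff_chain_at) (auto intro!: derivative_eq_intros has_vector_derivative_of_real)
  then show ?thesis
    by (simp add: matexp_entry c_def o_def)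
qed

lemma has_vector_derivative_matexp:
  fixes M :: "complex^'n^'n"
  shows "((\<lambda>t. matexp (t *\<^sub>R M)) has_vector_derivative M ** matexp (t *\<^sub>R M)) (at t within S)"
  by (rule has_vector_derivative_at_within, rule has_vector_derivative_vecI, rule has_vector_derivative_vecI)
    (rule has_vector_derivative_matexp_entry)

text \<open>Differentiation produces \<open>M\<close> on the left of the exponential, but the
  variation of constants below needs it on the right, next to the solution. Both products have the
  same power series because \<open>M\<close> commutes with its powers.\<close>

lemma matexp_commute:
  fixes M :: "complex^'n^'n"
  shows "matexp (t *\<^sub>R M) ** M = M ** matexp (t *\<^sub>R M)"
proof -
  have "(matexp (t *\<^sub>R M) ** M) $ i $ j = (M ** matexp (t *\<^sub>R M)) $ i $ j" for i j
  proof -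
    have s: "summable (\<lambda>k. (matpow M k $ i $ j / fact k) * of_real t ^ k * z)"
        "summable (\<lambda>k. z * ((matpow M k $ i $ j / fact k) * of_real t ^ k))" for i j z
      by (intro summable_mult summable_mult2 summable_matexp_entry)+
    have "(matexp (t *\<^sub>R M) ** M) $ i $ j =
        (\<Sum>k. \<Sum>l\<in>UNIV. (matpow M k $ i $ l / fact k) * of_real t ^ k * M $ l $ j)"
      by (simp only: matrix_matrix_mult_def matexp_entry vec_lambda_beta
          suminf_mult2[OF summable_matexp_entry] suminf_sum[OF s(1)])
    also have "\<dots> = (\<Sum>k. (matpow M k ** M) $ i $ j / fact k * of_real t ^ k)"
      by (intro arg_cong[where f=suminf] ext)
        (auto simp: matrix_matrix_mult_def sum_divide_distrib sum_distrib_right intro!: sum.cong)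
    also have "\<dots> = (\<Sum>k. (M ** matpow M k) $ i $ j / fact k * of_real t ^ k)"
      by (simp add: matpow_commute)
    also have "\<dots> = (\<Sum>k. \<Sum>l\<in>UNIV. M $ i $ l * ((matpow M k $ l $ j / fact k) * of_real t ^ k))"
      by (intro arg_cong[where f=suminf] ext)
        (auto simp: matrix_matrix_mult_def sum_divide_distrib sum_distrib_right intro!: sum.cong)
    also have "\<dots> = (M ** matexp (t *\<^sub>R M)) $ i $ j"
      by (simp only: matrix_matrix_mult_def matexp_entry vec_lambda_beta
          suminf_mult[OF summable_matexp_entry, symmetric] suminf_sum[OF s(2)])
    finally show ?thesis .
  qed
  then show ?thesis by (simp add: vec_eq_iff)
qed

section \<open>Orbits of the propagator and variation of constants\<close>

lemma bounded_bilinear_matrix_vector_mult: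
  "bounded_bilinear ((*v) :: 'a::{euclidean_space,real_normed_algebra_1}^'n^'m \<Rightarrow> 'a^'n \<Rightarrow> 'a^'m)"
proof -
  have "bilinear ((*v) :: 'a^'n^'m \<Rightarrow> 'a^'n \<Rightarrow> 'a^'m)"
    unfolding bilinear_def
    by (auto intro!: linearI simp: matrix_vector_mult_def vec_eq_iff algebra_simps sum.distrib scaleR_sum_right)
  then show ?thesis by (simp add: bilinear_conv_bounded_bilinear)
qed

lemma has_vector_derivative_matexp_vec:
  fixes M :: "complex^'n^'n"
  shows "((\<lambda>t. matexp (t *\<^sub>R M) *v x) has_vector_derivative M *v (matexp (t *\<^sub>R M) *v x)) (at t within S)"
  using bounded_linear.has_vector_derivative[OF
      bounded_bilinear.bounded_linear_left[OF bounded_bilinear_matrix_vector_mult]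
      has_vector_derivative_matexp]
  by (simp add: matrix_vector_mul_assoc)

lemma norm_matrix_vector_onorm:
  fixes M :: "complex^'n^'m"
  shows "norm (M *v x) \<le> onorm ((*v) M) * norm x"
  by (rule onorm) simp

text \<open>Instead of integrating Duhamel's formula, the mean value inequality is applied to the
  product of the backward propagator and \<open>z\<close>: its derivative contains only the forcing
  \<open>R\<close>.\<close>

lemma matexp_duhamel_estimate:
  fixes M :: "complex^'n^'n"
  assumes "t \<ge> 0"
    and K: "\<And>s. s \<in> {0..t} \<Longrightarrow> onorm ((*v) (matexp (s *\<^sub>R M))) \<le> K"
    and z: "\<And>s. s \<in> {0..t} \<Longrightarrow> (z has_vector_derivative M *v z s + R s) (at s within {0..t})"
    and R: "\<And>s. s \<in> {0..t} \<Longrightarrow> norm (R s) \<le> b"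
  shows "norm (z t - matexp (t *\<^sub>R M) *v z 0) \<le> t * K * b"
proof -
  have "K \<ge> 0" using K[of 0] assms(1) onorm_pos_le[OF matrix_vector_mul_bounded_linear] order_trans
    by (metis atLeastAtMost_iff order_refl)
  \<comment> \<open>The product of \<open>E s\<close> and \<open>z s\<close> runs from the freely
    propagated initial value at \<open>s = 0\<close> to \<open>z t\<close> at
    \<open>s = t\<close>.\<close>
  define E where "E s = matexp ((t - s) *\<^sub>R M)" for s
  have E: "(E has_vector_derivative - (E s ** M)) (at s within {0..t})" for s
  proof -
    have "((\<lambda>s. matexp (s *\<^sub>R M)) \<circ> (\<lambda>s. t - s) has_vector_derivative
        (- 1) *\<^sub>R (M ** matexp ((t - s) *\<^sub>R M))) (at s within {0..t})"
      by (intro vector_diff_chain_within has_vector_derivative_matexp)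
        (auto intro!: derivative_eq_intros)
    then show ?thesis by (simp add: E_def[abs_def] o_def matexp_commute)
  qed
  have d: "((\<lambda>s. E s *v z s) has_vector_derivative E s *v R s) (at s within {0..t})" if "s \<in> {0..t}" for s
  proof -
    have "((\<lambda>s. E s *v z s) has_vector_derivative E s *v (M *v z s + R s) + (- (E s ** M)) *v z s)
        (at s within {0..t})"
      by (rule bounded_bilinear.has_vector_derivative[OF bounded_bilinear_matrix_vector_mult E z[OF that]])
    moreover have "(- (E s ** M)) *v z s = - (E s *v (M *v z s))"
      unfolding matrix_vector_mul_assoc by (simp add: matrix_vector_mult_def vec_eq_iff sum_negf)
    ultimately show ?thesis by (simp add: matrix_vector_right_distrib)
  qed
  have "norm (E t *v z t - E 0 *v z 0) \<le> (K * b) * norm (t - 0)"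
  proof (rule differentiable_bound[where S="{0..t}" and f'="\<lambda>s h. h *\<^sub>R (E s *v R s)"])
    fix s assume s: "s \<in> {0..t}"
    show "((\<lambda>s. E s *v z s) has_derivative (\<lambda>h. h *\<^sub>R (E s *v R s))) (at s within {0..t})"
      using d[OF s] by (simp add: has_vector_derivative_def)
    have "onorm (\<lambda>h. h *\<^sub>R (E s *v R s)) = norm (E s *v R s)"
      using onorm_scaleR_left[OF bounded_linear_ident, of "E s *v R s"] by (simp add: onorm_id)
    also have "\<dots> \<le> onorm ((*v) (E s)) * norm (R s)"
      by (rule norm_matrix_vector_onorm)
    also have "\<dots> \<le> K * b"
      using s K[of "t - s"] R[OF s] \<open>K \<ge> 0\<close>
      by (intro mult_mono) (auto simp: E_def)
    finally show "onorm (\<lambda>h. h *\<^sub>R (E s *v R s)) \<le> K * b" .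
  qed (use \<open>t \<ge> 0\<close> in auto)
  then show ?thesis using \<open>t \<ge> 0\<close> by (simp add: E_def matexp_0 mult_ac)
qed

text \<open>Continuity on a compact time interval gives a bound that may depend on \<open>M\<close>
  and \<open>t\<close>. This is the crude input with which the circularity in the stability proof is
  broken.\<close>

lemma onorm_matexp_locally_bounded:
  fixes M :: "complex^'n^'n"
  shows "\<exists>K. \<forall>s\<in>{0..t}. onorm ((*v) (matexp (s *\<^sub>R M))) \<le> K"
proof -
  have "continuous_on {0..t} (\<lambda>s. matexp (s *\<^sub>R M))"
    by (rule continuous_on_vector_derivative) (rule has_vector_derivative_matexp)
  then have "compact ((\<lambda>s. matexp (s *\<^sub>R M)) ` {0..t})"
    by (rule compact_continuous_image) simp
  then obtain B where B: "\<forall>x\<in>(\<lambda>s. matexp (s *\<^sub>R M)) ` {0..t}. norm x \<le> B"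
    by (meson bounded_iff compact_imp_bounded)
  obtain c where c: "\<And>(N::complex^'n^'n) x. norm (N *v x) \<le> norm N * norm x * c" "c > 0"
    using bounded_bilinear.pos_bounded[OF bounded_bilinear_matrix_vector_mult[where ?'a=complex]] by auto
  show ?thesis
  proof (intro exI ballI onorm_le)
    fix s and x :: "complex^'n" assume "s \<in> {0..t}"
    then have "norm (matexp (s *\<^sub>R M)) \<le> B" using B by auto
    then have "norm (matexp (s *\<^sub>R M)) * norm x * c \<le> B * norm x * c"
      using c by (intro mult_right_mono) auto
    then show "norm (matexp (s *\<^sub>R M) *v x) \<le> (B * c) * norm x"
      using c(1)[of "matexp (s *\<^sub>R M)" x] by (simp add: mult_ac)
  qed
qed

section \<open>The corrected slow variable\<close>

lemma bounded_linear_slow: "bounded_linear (slow :: 'a::euclidean_space^('m::finite + 'r::finite) \<Rightarrow> 'a^'m)"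
  unfolding linear_conv_bounded_linear[symmetric]
  by (auto intro!: linearI simp: slow_def vec_eq_iff)

lemma sum_UNIV_Plus:
  "(\<Sum>k\<in>(UNIV :: ('m::finite + 'r::finite) set). f k) = (\<Sum>i\<in>UNIV. f (Inl i)) + (\<Sum>j\<in>UNIV. f (Inr j))"
  unfolding UNIV_Plus_UNIV[symmetric] by (simp add: sum.Plus o_def del: UNIV_Plus_UNIV)

lemma norm_slow_le: "norm (slow w) \<le> norm w"
proof -
  have "(norm (slow w))\<^sup>2 \<le> (norm w)\<^sup>2"
    by (simp add: norm_vec_def L2_set_def slow_def sum_UNIV_Plus sum_nonneg)
  then show ?thesis by (rule power2_le_imp_le) simp
qed

definition embed_slow :: "'a::zero^'m \<Rightarrow> 'a^('m::finite + 'r::finite)" where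
  "embed_slow v = (\<chi> k. case k of Inl i \<Rightarrow> v $ i | Inr j \<Rightarrow> 0)"

lemma slow_embed_slow [simp]: "slow (embed_slow v) = v"
  by (simp add: slow_def embed_slow_def vec_eq_iff)

lemma norm_embed_slow [simp]: "norm (embed_slow v) = norm v"
  by (simp add: norm_vec_def L2_set_def embed_slow_def sum_UNIV_Plus)

lemma slow_mult_embed_slow: "slow (M *v embed_slow v) = block11 M *v v"
  by (simp add: slow_def block11_def embed_slow_def matrix_vector_mult_def sum_UNIV_Plus vec_eq_iff)

lemma H_conv_flux: "H A Q \<xi> \<eta> = \<eta> *\<^sub>R map_matrix complex_of_real Q + flux_symbol A \<xi>"
  by (simp add: H_def map_matrix_def vec_eq_iff scaleR_conv_of_real[where 'a=complex])

lemma block11_flux_symbol: "block11 (flux_symbol A \<xi>) = flux_symbol (\<lambda>j. block11 (A j)) \<xi>"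
  by (simp add: flux_symbol_def block11_def map_matrix_def vec_eq_iff)

lemma slow_relaxation_block_form:
  assumes "relaxation_block_form Q"
  shows "slow (map_matrix complex_of_real Q *v w) = 0"
proof -
  have "Q $ Inl i $ Inl j = 0" "Q $ Inl i $ Inr k = 0" for i j k
    using assms unfolding relaxation_block_form_def block11_def block12_def by (auto simp: vec_eq_iff)
  then show ?thesis
    by (simp add: slow_def matrix_vector_mult_def map_matrix_def sum_UNIV_Plus vec_eq_iff)
qed

text \<open>\<open>P\<close> carries an inverse of \<open>block22 Q\<close> in the fast block and
  zeros elsewhere, so \<open>P Q\<close> is the projection onto the fast variables.\<close>

lemma relaxation_pseudo_inverse:
  fixes Q :: "real^('m::finite + 'r::finite)^('m + 'r)"
  assumes "relaxation_block_form Q"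
  obtains P :: "complex^('m + 'r)^('m + 'r)"
    where "\<And>w. P *v (map_matrix complex_of_real Q *v w) = w - embed_slow (slow w)"
proof -
  obtain B' where B': "B' ** block22 Q = mat 1"
    using assms unfolding relaxation_block_form_def invertible_def by auto
  define P :: "complex^('m + 'r)^('m + 'r)" where
    "P = (\<chi> k l. case k of Inl i \<Rightarrow> 0 | Inr i \<Rightarrow>
       (case l of Inl j \<Rightarrow> 0 | Inr j \<Rightarrow> complex_of_real (B' $ i $ j)))"
  have Q0: "Q $ Inr i $ Inl j = 0" for i j
    using assms unfolding relaxation_block_form_def block21_def by (auto simp: vec_eq_iff)
  have B1: "(\<Sum>k\<in>UNIV. complex_of_real (B' $ i $ k) * complex_of_real (Q $ Inr k $ Inr j)) = (if i = j then 1 else 0)" for i j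
  proof -
    have "(\<Sum>k\<in>UNIV. B' $ i $ k * Q $ Inr k $ Inr j) = (if i = j then 1 else 0)"
      using arg_cong[OF B', of "\<lambda>X. X $ i $ j"] by (simp add: matrix_matrix_mult_def block22_def mat_def)
    from arg_cong[OF this, of complex_of_real] show ?thesis by (auto split: if_splits)
  qed
  have PQ: "(P ** map_matrix complex_of_real Q) $ k $ l =
      (case k of Inl i \<Rightarrow> 0 | Inr i \<Rightarrow> (case l of Inl j \<Rightarrow> 0 | Inr j \<Rightarrow> if i = j then 1 else 0))" for k l
    by (auto simp: matrix_matrix_mult_def P_def map_matrix_def sum_UNIV_Plus Q0 B1 split: sum.splits)
  have "(P *v (map_matrix complex_of_real Q *v w)) $ k = (w - embed_slow (slow w)) $ k" for w k
    unfolding matrix_vector_mul_assoc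
    unfolding matrix_vector_mult_def[of "P ** _"] vec_lambda_beta PQ sum_UNIV_Plus
    by (auto simp: embed_slow_def slow_def if_distribR if_distrib cong: if_cong split: sum.splits)
  then have "P *v (map_matrix complex_of_real Q *v w) = w - embed_slow (slow w)" for w
    by (simp add: vec_eq_iff)
  then show thesis by (rule that)
qed

section \<open>Estimates at a fixed frequency\<close>

lemma linear_flux_symbol: "linear (flux_symbol A)"
  by (auto intro!: linearI simp: flux_symbol_def map_matrix_def vec_eq_iff algebra_simps sum.distrib
      sum_distrib_left scaleR_conv_of_real[where 'a=complex])

text \<open>The expression is bilinear in frequency and vector, hence bounded in finite dimension.
  One constant serves all frequencies, and each application of the symbol costs one power of
  \<open>norm \<xi>\<close>.\<close>

lemma norm_flux_symbol_mult_le: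
  obtains c where "c \<ge> 0" "\<And>\<xi> w. norm (flux_symbol A \<xi> *v w) \<le> c * norm \<xi> * norm w"
proof -
  have "bilinear (\<lambda>\<xi>. (*v) (flux_symbol A \<xi>))"
    unfolding bilinear_def
  proof (intro conjI allI)
    fix w
    have "linear ((\<lambda>M. M *v w) \<circ> flux_symbol A)"
      by (intro linear_compose linear_flux_symbol bounded_linear.linear
          bounded_bilinear.bounded_linear_left[OF bounded_bilinear_matrix_vector_mult])
    then show "linear (\<lambda>\<xi>. flux_symbol A \<xi> *v w)" by (simp add: o_def)
  qed simp
  then have "bounded_bilinear (\<lambda>\<xi>. (*v) (flux_symbol A \<xi>))"
    by (simp add: bilinear_conv_bounded_bilinear)
  then obtain c where "c > 0" "\<And>\<xi> w. norm (flux_symbol A \<xi> *v w) \<le> norm \<xi> * norm w * c"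
    using bounded_bilinear.pos_bounded by blast
  then show thesis by (intro that[of c]) (auto simp: mult_ac)
qed

text \<open>The order of quantifiers matters: \<open>c\<close> comes from \<open>A\<close> and
  \<open>Q\<close> alone, while \<open>K\<close> is a parameter. The estimate is used twice, with a
  \<open>K\<close> that depends on frequency and time to pass to the limit in
  \<open>\<epsilon>\<close>, and afterwards with the uniform bound. The first stability premise
  concerns only the orbit of \<open>w\<close>.\<close>

lemma slow_matexp_relaxation_estimate:
  fixes A :: "'d::finite \<Rightarrow> real^('m::finite + 'r::finite)^('m + 'r)"
  assumes Q: "relaxation_block_form Q"
  obtains c where "c \<ge> 0"
    "\<And>\<xi> \<epsilon> t K w. \<lbrakk>\<epsilon> > 0; t \<ge> 0; K \<ge> 1;
       \<And>s. s \<in> {0..t} \<Longrightarrow> norm (matexp (s *\<^sub>R H A Q \<xi> (1 / \<epsilon>)) *v w) \<le> K * norm w;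
       \<And>s. s \<in> {0..t} \<Longrightarrow> onorm ((*v) (matexp (s *\<^sub>R flux_symbol (\<lambda>j. block11 (A j)) \<xi>))) \<le> K\<rbrakk> \<Longrightarrow>
     norm (slow (matexp (t *\<^sub>R H A Q \<xi> (1 / \<epsilon>)) *v w) -
        matexp (t *\<^sub>R flux_symbol (\<lambda>j. block11 (A j)) \<xi>) *v slow w)
     \<le> c * \<epsilon> * K\<^sup>2 * (1 + t) * (1 + (norm \<xi>)\<^sup>2) * norm w"
proof -
  define QC where "QC = map_matrix complex_of_real Q"
  obtain P :: "complex^('m + 'r)^('m + 'r)" where P: "\<And>w. P *v (QC *v w) = w - embed_slow (slow w)"
    using relaxation_pseudo_inverse[OF Q] unfolding QC_def by blast
  obtain p where p: "p > 0" "\<And>w. norm (P *v w) \<le> norm w * p"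
    using bounded_linear.pos_bounded[OF matrix_vector_mul_bounded_linear[of P]] by blast
  obtain a where a: "a \<ge> 0" "\<And>\<xi> w. norm (flux_symbol A \<xi> *v w) \<le> a * norm \<xi> * norm w"
    by (rule norm_flux_symbol_mult_le) blast
  obtain b where b: "b \<ge> 0"
    "\<And>\<xi> w. norm (flux_symbol (\<lambda>j. block11 (A j)) \<xi> *v w) \<le> b * norm \<xi> * norm w"
    by (rule norm_flux_symbol_mult_le) blast
  define c where "c = a * p * (1 + a + b)"
  show thesis
  proof (rule that[of c])
    show "c \<ge> 0" using a b p by (simp add: c_def)
  next
    fix \<xi> :: "real^'d" and \<epsilon> t K :: real and w
    assume \<epsilon>: "\<epsilon> > 0" and t: "t \<ge> 0" and K_1: "K \<ge> 1"
      and K: "\<And>s. s \<in> {0..t} \<Longrightarrow> norm (matexp (s *\<^sub>R H A Q \<xi> (1 / \<epsilon>)) *v w) \<le> K * norm w"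
      and K1: "\<And>s. s \<in> {0..t} \<Longrightarrow> onorm ((*v) (matexp (s *\<^sub>R flux_symbol (\<lambda>j. block11 (A j)) \<xi>))) \<le> K"
    define L where "L = flux_symbol A \<xi>"
    define M where "M = flux_symbol (\<lambda>j. block11 (A j)) \<xi>"
    define n where "n = norm \<xi>"
    define T where "T w = slow (L *v (P *v w))" for w
    define U where "U s = matexp (s *\<^sub>R H A Q \<xi> (1 / \<epsilon>)) *v w" for s
    define z where "z s = slow (U s) - \<epsilon> *\<^sub>R T (U s)" for s
    \<comment> \<open>Beyond the symbol inside \<open>T\<close>, each of the two terms contains one
      further factor \<open>M\<close> or \<open>L\<close>, so \<open>R\<close> is of order
      \<open>\<epsilon>\<close> times the square of the frequency.\<close>
    define R where "R s = \<epsilon> *\<^sub>R (M *v T (U s) - T (L *v U s))" for s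
    have n: "n \<ge> 0" by (simp add: n_def)
    have L: "norm (L *v w) \<le> a * n * norm w" and M: "norm (M *v v) \<le> b * n * norm v" for w v
      using a(2) b(2) by (auto simp: L_def M_def n_def)
    have T: "norm (T w) \<le> a * p * n * norm w" for w
    proof -
      have "norm (T w) \<le> norm (L *v (P *v w))" by (simp add: T_def norm_slow_le)
      also have "\<dots> \<le> a * n * norm (P *v w)" by (rule L)
      also have "\<dots> \<le> a * n * (norm w * p)" by (intro mult_left_mono p(2)) (use a n in auto)
      finally show ?thesis by (simp add: mult_ac)
    qed
    have linT: "bounded_linear T"
      unfolding T_def
      by (intro bounded_linear_compose[OF bounded_linear_slow]
          bounded_linear_compose[OF matrix_vector_mul_bounded_linear] matrix_vector_mul_bounded_linear)
    \<comment> \<open>This identity is the reason for the choice of \<open>T\<close>. The right side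
      is the part of the slow equation that is driven by the fast components; on the left,
      \<open>Q\<close> meets the factor \<open>1 / \<epsilon>\<close> in \<open>H\<close>, which the
      \<open>\<epsilon>\<close> in front of \<open>T\<close> cancels.\<close>
    have TQ: "T (QC *v w) = slow (L *v w) - M *v slow w" for w
      unfolding T_def P M_def block11_flux_symbol[symmetric] L_def
      by (simp add: matrix_vector_mult_diff_distrib slow_mult_embed_slow[symmetric]
          linear_diff[OF bounded_linear.linear[OF bounded_linear_slow]])
    have HU: "H A Q \<xi> (1 / \<epsilon>) *v w = (1 / \<epsilon>) *\<^sub>R (QC *v w) + L *v w" for w
      by (simp add: H_conv_flux QC_def L_def matrix_vector_mult_add_rdistrib
            bounded_bilinear.scaleR_left[OF bounded_bilinear_matrix_vector_mult])
    have z': "(z has_vector_derivative M *v z s + R s) (at s within {0..t})" for s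
    proof -
      have "(z has_vector_derivative slow (H A Q \<xi> (1 / \<epsilon>) *v U s) - \<epsilon> *\<^sub>R T (H A Q \<xi> (1 / \<epsilon>) *v U s))
          (at s within {0..t})"
        unfolding z_def U_def
        by (intro has_vector_derivative_diff bounded_linear.has_vector_derivative[OF bounded_linear_slow]
            bounded_linear.has_vector_derivative[OF bounded_linear_scaleR_right]
            bounded_linear.has_vector_derivative[OF linT] has_vector_derivative_matexp_vec)
      moreover have "slow (H A Q \<xi> (1 / \<epsilon>) *v U s) - \<epsilon> *\<^sub>R T (H A Q \<xi> (1 / \<epsilon>) *v U s) = M *v z s + R s"
      proof -
        have "slow (H A Q \<xi> (1 / \<epsilon>) *v U s) = slow (L *v U s)"
          unfolding HU using slow_relaxation_block_form[OF Q, of "U s"]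
          by (simp add: linear_add[OF bounded_linear.linear[OF bounded_linear_slow]]
              linear_scale[OF bounded_linear.linear[OF bounded_linear_slow]] QC_def)
        moreover have "\<epsilon> *\<^sub>R T (H A Q \<xi> (1 / \<epsilon>) *v U s) = slow (L *v U s) - M *v slow (U s) + \<epsilon> *\<^sub>R T (L *v U s)"
          unfolding HU using \<epsilon>
          by (simp add: linear_add[OF bounded_linear.linear[OF linT]]
              linear_scale[OF bounded_linear.linear[OF linT]] TQ scaleR_add_right)
        ultimately show ?thesis
          by (simp add: z_def R_def matrix_vector_mult_diff_distrib bounded_bilinear.scaleR_right[OF bounded_bilinear_matrix_vector_mult] scaleR_diff_right)
      qed
      ultimately show ?thesis by simp
    qed
    have UK: "norm (U s) \<le> K * norm w" if "s \<in> {0..t}" for s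
      using K[OF that] by (simp add: U_def)
    define D where "D = \<epsilon> * ((a * p * (a + b)) * n\<^sup>2 * (K * norm w))"
    have RD: "norm (R s) \<le> D" if s: "s \<in> {0..t}" for s
    proof -
      have "norm (M *v T (U s)) \<le> b * n * (a * p * n * norm (U s))"
        by (rule order_trans[OF M]) (intro mult_left_mono T, use b n in auto)
      moreover have "norm (T (L *v U s)) \<le> a * p * n * (a * n * norm (U s))"
        by (rule order_trans[OF T]) (intro mult_left_mono L, use a p n in auto)
      ultimately have "norm (M *v T (U s) - T (L *v U s)) \<le> (a * p * (a + b)) * n\<^sup>2 * norm (U s)"
        using norm_triangle_ineq4[of "M *v T (U s)" "T (L *v U s)"]
        by (simp add: power2_eq_square algebra_simps)
      also have "\<dots> \<le> (a * p * (a + b)) * n\<^sup>2 * (K * norm w)"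
        by (intro mult_left_mono UK s) (use a b p in auto)
      finally show ?thesis
        using \<epsilon> by (simp add: R_def D_def)
    qed
    have "norm (z t - matexp (t *\<^sub>R M) *v z 0) \<le> t * K * D"
      by (rule matexp_duhamel_estimate[where R=R]) (use t K1 z' RD in \<open>auto simp: M_def\<close>)
    \<comment> \<open>Returning from \<open>z\<close> to \<open>slow U\<close> costs the correction
      at time \<open>t\<close> and the propagated correction at time \<open>0\<close>.\<close>
    moreover have "slow (U t) - matexp (t *\<^sub>R M) *v slow w =
        (z t - matexp (t *\<^sub>R M) *v z 0) + \<epsilon> *\<^sub>R T (U t) - \<epsilon> *\<^sub>R (matexp (t *\<^sub>R M) *v T w)"
      by (simp add: z_def U_def matexp_0 matrix_vector_mult_diff_distrib bounded_bilinear.scaleR_right[OF bounded_bilinear_matrix_vector_mult])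
    ultimately have "norm (slow (U t) - matexp (t *\<^sub>R M) *v slow w)
        \<le> t * K * D + \<epsilon> * norm (T (U t)) + \<epsilon> * norm (matexp (t *\<^sub>R M) *v T w)"
      using \<epsilon> norm_triangle_ineq4[of "(z t - matexp (t *\<^sub>R M) *v z 0) + \<epsilon> *\<^sub>R T (U t)" "\<epsilon> *\<^sub>R (matexp (t *\<^sub>R M) *v T w)"]
        norm_triangle_ineq[of "z t - matexp (t *\<^sub>R M) *v z 0" "\<epsilon> *\<^sub>R T (U t)"]
      by simp
    also have "norm (T (U t)) \<le> a * p * n * (K * norm w)"
      by (rule order_trans[OF T]) (intro mult_left_mono UK, use a p n t in auto)
    also have "norm (matexp (t *\<^sub>R M) *v T w) \<le> K * (a * p * n * norm w)"
      by (rule order_trans[OF norm_matrix_vector_onorm] mult_mono)+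
        (use K1 t T K_1 in \<open>auto simp: M_def\<close>)
    finally have "norm (slow (U t) - matexp (t *\<^sub>R M) *v slow w)
        \<le> t * K * D + \<epsilon> * (a * p * n * (K * norm w)) + \<epsilon> * (K * (a * p * n * norm w))"
      using \<epsilon> by (simp add: mult_left_mono)
    also have "\<dots> \<le> c * \<epsilon> * K\<^sup>2 * (1 + t) * (1 + n\<^sup>2) * norm w"
    proof -
      define W where "W = \<epsilon> * a * p * K * norm w"
      have W: "W \<ge> 0" using \<epsilon> a p K_1 by (simp add: W_def)
      \<comment> \<open>The two corrections are of first order in the frequency; this absorbs them
        into the weight that the forcing term requires.\<close>
      have "2 * n \<le> 1 + n\<^sup>2" using zero_le_power2[of "n - 1"] by (simp add: power2_diff)
      have "t * K * D + \<epsilon> * (a * p * n * (K * norm w)) + \<epsilon> * (K * (a * p * n * norm w))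
          = W * (K * (t * ((a + b) * n\<^sup>2)) + 2 * n)"
        by (simp add: D_def W_def algebra_simps)
      also have "\<dots> \<le> W * (K * (t * ((a + b) * n\<^sup>2)) + K * (1 + n\<^sup>2))"
        using W K_1 \<open>2 * n \<le> 1 + n\<^sup>2\<close> mult_right_mono[of 1 K "1 + n\<^sup>2"]
        by (intro mult_left_mono add_left_mono) auto
      also have "\<dots> = W * K * (t * ((a + b) * n\<^sup>2) + (1 + n\<^sup>2))"
        by (simp add: algebra_simps)
      also have "\<dots> \<le> W * K * ((1 + a + b) * (1 + t) * (1 + n\<^sup>2))"
      proof (intro mult_left_mono)
        have "(1 + a + b) * (1 + t) * (1 + n\<^sup>2) - (t * ((a + b) * n\<^sup>2) + (1 + n\<^sup>2))
            = (a + b) * (1 + t) + (a + b) * n\<^sup>2 + t * (1 + n\<^sup>2)"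
          by (simp add: algebra_simps)
        also have "\<dots> \<ge> 0" using a b t by simp
        finally show "t * ((a + b) * n\<^sup>2) + (1 + n\<^sup>2) \<le> (1 + a + b) * (1 + t) * (1 + n\<^sup>2)" by simp
      qed (use W K_1 in auto)
      also have "\<dots> = c * \<epsilon> * K\<^sup>2 * (1 + t) * (1 + n\<^sup>2) * norm w"
        by (simp add: W_def c_def power2_eq_square)
      finally show ?thesis .
    qed
    finally show "norm (slow (matexp (t *\<^sub>R H A Q \<xi> (1 / \<epsilon>)) *v w) -
        matexp (t *\<^sub>R flux_symbol (\<lambda>j. block11 (A j)) \<xi>) *v slow w)
     \<le> c * \<epsilon> * K\<^sup>2 * (1 + t) * (1 + (norm \<xi>)\<^sup>2) * norm w"
      by (simp add: U_def M_def n_def)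
  qed
qed

section \<open>Translations and Gaussians\<close>

lemma borel_measurable_cis [measurable]: "cis \<in> borel_measurable borel"
  by (intro borel_measurable_continuous_onI continuous_intros)

lemma borel_measurable_cnj [measurable]: "cnj \<in> borel_measurable borel"
  by (intro borel_measurable_continuous_onI continuous_intros)

section \<open>Translation, reflection and dilation of Lebesgue integrals\<close>

lemma lborel_distr_diff: "distr lborel borel (\<lambda>x. x - w) = (lborel :: 'a::euclidean_space measure)"
proof -
  have "(\<lambda>x. x - w) = (+) (- w)" by auto
  then show ?thesis by (simp only: lborel_distr_plus)
qed

lemma lborel_distr_diff_left: "distr lborel borel (\<lambda>w. x - w) = (lborel :: 'a::euclidean_space measure)"
  by (subst lborel_affine[of "-1" x]) (auto simp: density_1)

lemma
  fixes f :: "'a::euclidean_space \<Rightarrow> 'b::{banach, second_countable_topology}"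
  assumes [measurable]: "f \<in> borel_measurable borel"
  shows lborel_integral_diff: "(\<integral>x. f (x - w) \<partial>lborel) = (\<integral>x. f x \<partial>lborel)"
    and lborel_integrable_diff: "integrable lborel (\<lambda>x. f (x - w)) \<longleftrightarrow> integrable lborel f"
    and lborel_integral_diff_left: "(\<integral>w. f (x - w) \<partial>lborel) = (\<integral>x. f x \<partial>lborel)"
    and lborel_integrable_diff_left: "integrable lborel (\<lambda>w. f (x - w)) \<longleftrightarrow> integrable lborel f"
proof -
  show "(\<integral>x. f (x - w) \<partial>lborel) = (\<integral>x. f x \<partial>lborel)"
    by (subst (2) lborel_distr_diff[of w, symmetric]) (simp add: integral_distr)
  show "integrable lborel (\<lambda>x. f (x - w)) \<longleftrightarrow> integrable lborel f"
    by (subst (2) lborel_distr_diff[of w, symmetric]) (simp add: integrable_distr_eq)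
  show "(\<integral>w. f (x - w) \<partial>lborel) = (\<integral>x. f x \<partial>lborel)"
    by (subst (2) lborel_distr_diff_left[of x, symmetric]) (simp add: integral_distr)
  show "integrable lborel (\<lambda>w. f (x - w)) \<longleftrightarrow> integrable lborel f"
    by (subst (2) lborel_distr_diff_left[of x, symmetric]) (simp add: integrable_distr_eq)
qed

lemma
  fixes f :: "'a::euclidean_space \<Rightarrow> 'b::{banach, second_countable_topology}"
  assumes c: "c \<noteq> 0" and f[measurable]: "f \<in> borel_measurable borel"
  shows lborel_integral_scale: "(\<integral>x. f x \<partial>lborel) = \<bar>c\<bar> ^ DIM('a) *\<^sub>R (\<integral>x. f (c *\<^sub>R x) \<partial>lborel)"
    and lborel_integrable_scale: "integrable lborel (\<lambda>x. f (c *\<^sub>R x)) \<longleftrightarrow> integrable lborel f"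
proof -
  have eq: "lborel = density (distr lborel borel (\<lambda>x::'a. c *\<^sub>R x)) (\<lambda>_. ennreal (\<bar>c\<bar> ^ DIM('a)))"
    using lborel_affine[OF c, of "0::'a"] by (simp add: ennreal_power)
  show "(\<integral>x. f x \<partial>lborel) = \<bar>c\<bar> ^ DIM('a) *\<^sub>R (\<integral>x. f (c *\<^sub>R x) \<partial>lborel)"
    by (subst eq) (simp add: integral_density integral_distr)
  show "integrable lborel (\<lambda>x. f (c *\<^sub>R x)) \<longleftrightarrow> integrable lborel f"
  proof -
    have "integrable lborel f \<longleftrightarrow> integrable lborel (\<lambda>x. \<bar>c\<bar> ^ DIM('a) *\<^sub>R f (c *\<^sub>R x))"
      by (subst eq, subst integrable_density) (auto simp: integrable_distr_eq)
    also have "\<dots> \<longleftrightarrow> integrable lborel (\<lambda>x. f (c *\<^sub>R x))"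
      using integrable_scaleR_right[of "inverse (\<bar>c\<bar> ^ DIM('a))" lborel "\<lambda>x. \<bar>c\<bar> ^ DIM('a) *\<^sub>R f (c *\<^sub>R x)"] c
      by auto
    finally show ?thesis by simp
  qed
qed

text \<open>With variance one and no normalising factor, the Fourier integral is a constant multiple
  of the same function, so this one function serves both in space and in frequency.\<close>

definition gauss :: "'a::euclidean_space \<Rightarrow> real" where
  "gauss x = exp (- (norm x)\<^sup>2 / 2)"

lemma gauss_pos: "gauss x > 0" and gauss_le_1: "gauss x \<le> 1"
  by (auto simp: gauss_def)

lemma borel_measurable_gauss [measurable]: "gauss \<in> borel_measurable borel"
  unfolding gauss_def by measurable

text \<open>This is the characteristic function of the standard normal distribution, evaluated at
  \<open>- s\<close> to match the sign of the phase.\<close>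

lemma gauss_fourier_real:
  fixes s :: real
  shows "integrable lborel (\<lambda>x::real. cis (- (x * s)) * complex_of_real (exp (- x\<^sup>2 / 2)))"
    and "(\<integral>x. cis (- (x * s)) * complex_of_real (exp (- x\<^sup>2 / 2)) \<partial>lborel)
      = complex_of_real (sqrt (2 * pi) * exp (- s\<^sup>2 / 2))"
proof -
  have d: "std_normal_density x = exp (- x\<^sup>2 / 2) / sqrt (2 * pi)" for x
    by (simp add: std_normal_density_def)
  have "integrable lborel (\<lambda>x. sqrt (2 * pi) * std_normal_density x)" by simp
  then have i: "integrable lborel (\<lambda>x::real. exp (- x\<^sup>2 / 2))" by (simp add: d)
  show "integrable lborel (\<lambda>x::real. cis (- (x * s)) * complex_of_real (exp (- x\<^sup>2 / 2)))"
    by (rule Bochner_Integration.integrable_bound[OF i]) (auto simp: norm_mult)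
  have "complex_of_real (exp (- s\<^sup>2 / 2)) = char std_normal_distribution (- s)"
    by (simp add: char_std_normal_distribution)
  also have "\<dots> = (\<integral>x. std_normal_density x *\<^sub>R iexp (- s * x) \<partial>lborel)"
    unfolding char_def by (subst integral_density) (auto simp: normal_density_nonneg)
  also have "\<dots> = (\<integral>x. (1 / sqrt (2 * pi)) *\<^sub>R (cis (- (x * s)) * complex_of_real (exp (- x\<^sup>2 / 2))) \<partial>lborel)"
    by (intro Bochner_Integration.integral_cong refl)
      (simp add: d cis_conv_exp scaleR_conv_of_real mult_ac)
  finally show "(\<integral>x. cis (- (x * s)) * complex_of_real (exp (- x\<^sup>2 / 2)) \<partial>lborel)
      = complex_of_real (sqrt (2 * pi) * exp (- s\<^sup>2 / 2))"
    by (simp add: scaleR_conv_of_real)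
qed

text \<open>Phase and Gaussian both factor over the coordinates, and Lebesgue measure is the image
  of a product of one-dimensional ones, so the integral is the product of the one-dimensional
  integrals.\<close>

lemma
  fixes z :: "'a::euclidean_space"
  shows integrable_gauss_fourier: "integrable lborel (\<lambda>x::'a. cis (- (x \<bullet> z)) * complex_of_real (gauss x))"
    and integral_gauss_fourier: "(\<integral>x. cis (- (x \<bullet> z)) * complex_of_real (gauss x) \<partial>lborel)
      = complex_of_real (sqrt (2 * pi) ^ DIM('a) * gauss z)"
proof -
  interpret product_sigma_finite "\<lambda>_::'a. lborel :: real measure" ..
  define \<phi> where "\<phi> b x = cis (- (x * (z \<bullet> b))) * complex_of_real (exp (- x\<^sup>2 / 2))" for b :: 'a and x :: real
  have norm_Basis: "(norm x)\<^sup>2 = (\<Sum>b\<in>Basis. (x \<bullet> b)\<^sup>2)" for x :: 'a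
    unfolding power2_norm_eq_inner by (subst euclidean_inner) (simp add: power2_eq_square)
  have prod: "cis (- (x \<bullet> z)) * complex_of_real (gauss x) = (\<Prod>b\<in>Basis. \<phi> b (x \<bullet> b))" for x
  proof -
    have "cis (- (x \<bullet> z)) = (\<Prod>b\<in>Basis. cis (- (x \<bullet> b * (z \<bullet> b))))"
      unfolding cis_conv_exp by (subst euclidean_inner) (simp add: sum_negf sum_distrib_left flip: exp_sum)
    moreover have "gauss x = (\<Prod>b\<in>Basis. exp (- (x \<bullet> b)\<^sup>2 / 2))"
      unfolding gauss_def norm_Basis
      by (subst exp_sum[symmetric]) (simp_all add: sum_divide_distrib sum_negf)
    ultimately show ?thesis by (simp only: \<phi>_def prod.distrib of_real_prod)
  qed
  have p: "cis (- ((\<Sum>b\<in>Basis. f b *\<^sub>R b) \<bullet> z)) * complex_of_real (gauss (\<Sum>b\<in>Basis. f b *\<^sub>R b))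
      = (\<Prod>b\<in>Basis. \<phi> b (f b))" for f
    unfolding prod by (intro prod.cong refl) (simp add: inner_sum_left_Basis)
  have m: "(\<lambda>f. \<Sum>b\<in>Basis. f b *\<^sub>R b) \<in> (\<Pi>\<^sub>M b\<in>(Basis::'a set). lborel) \<rightarrow>\<^sub>M borel"
    by measurable
  have int: "integrable lborel (\<phi> b)" for b
    unfolding \<phi>_def by (rule gauss_fourier_real)
  show "integrable lborel (\<lambda>x::'a. cis (- (x \<bullet> z)) * complex_of_real (gauss x))"
    by (subst lborel_eq, subst integrable_distr_eq[OF m])
      (auto simp: p intro!: product_integrable_prod int)
  have "(\<integral>x. cis (- (x \<bullet> z)) * complex_of_real (gauss x) \<partial>lborel)
      = (\<integral>f. (\<Prod>b\<in>Basis. \<phi> b (f b)) \<partial>(\<Pi>\<^sub>M b\<in>(Basis::'a set). lborel))"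
    by (subst lborel_eq, subst integral_distr[OF m]) (auto simp: p)
  also have "\<dots> = (\<Prod>b\<in>Basis. complex_of_real (sqrt (2 * pi) * exp (- (z \<bullet> b)\<^sup>2 / 2)))"
    unfolding \<phi>_def gauss_fourier_real(2)[symmetric]
    by (rule product_integral_prod) (auto intro: gauss_fourier_real(1)[simplified])
  also have "\<dots> = complex_of_real (sqrt (2 * pi) ^ DIM('a) * gauss z)"
  proof -
    have "gauss z = (\<Prod>b\<in>Basis. exp (- (z \<bullet> b)\<^sup>2 / 2))"
      unfolding gauss_def norm_Basis
      by (subst exp_sum[symmetric]) (simp_all add: sum_divide_distrib sum_negf)
    then show ?thesis by (simp add: prod.distrib)
  qed
  finally show "(\<integral>x. cis (- (x \<bullet> z)) * complex_of_real (gauss x) \<partial>lborel)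
      = complex_of_real (sqrt (2 * pi) ^ DIM('a) * gauss z)" .
qed

lemma integrable_gauss: "integrable lborel (gauss :: 'a::euclidean_space \<Rightarrow> real)"
  and integral_gauss: "(\<integral>x. gauss x \<partial>(lborel :: 'a measure)) = sqrt (2 * pi) ^ DIM('a)"
proof -
  show i: "integrable lborel (gauss :: 'a \<Rightarrow> real)"
    using integrable_norm[OF integrable_gauss_fourier[of "0::'a"]] by (simp add: gauss_pos less_imp_le)
  have "complex_of_real (\<integral>x. gauss x \<partial>(lborel :: 'a measure)) = complex_of_real (sqrt (2 * pi) ^ DIM('a))"
    using integral_gauss_fourier[of "0::'a"] by (simp add: gauss_def[of "0::'a"])
  then show "(\<integral>x. gauss x \<partial>(lborel :: 'a measure)) = sqrt (2 * pi) ^ DIM('a)"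
    by (simp only: of_real_eq_iff)
qed

text \<open>The case of a set \<open>A\<close> of finite measure rests on regularity:
  \<open>A\<close> is squeezed between a compact \<open>K\<close> and an open \<open>U\<close>, and
  a short shift cannot carry \<open>K\<close> out of \<open>U\<close>. Sums and dominated limits
  extend this to all integrable functions.\<close>

lemma L1_translation_continuous:
  fixes f :: "'a::euclidean_space \<Rightarrow> 'b::{banach, second_countable_topology}"
  assumes "integrable lborel f"
  shows "((\<lambda>w. \<integral>x. norm (f (x - w) - f x) \<partial>lborel) \<longlongrightarrow> 0) (at 0)"
  using assms
proof (induction rule: integrable_induct)
  case (base A c)
  then have A[measurable]: "A \<in> sets borel" by simp
  show ?case
  proof (rule tendstoI)
    fix e :: real assume "e > 0"
    \<comment> \<open>The final bound is \<open>4 * d * norm c\<close>; the summand \<open>1\<close>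
      covers \<open>c = 0\<close>.\<close>
    define d where "d = e / (4 * (norm c + 1))"
    have "d > 0" using \<open>e > 0\<close> by (simp add: d_def add_nonneg_pos)
    obtain U where U: "open U" "A \<subseteq> U" "emeasure lborel (U - A) < ennreal d"
      using outer_regular_lborel[OF A \<open>d > 0\<close>] by blast
    obtain K where K: "compact K" "K \<subseteq> A" "emeasure lborel A < emeasure lborel K + ennreal d"
    proof -
      \<comment> \<open>Inner regularity is applied to a finite measure, so Lebesgue measure is
        first restricted to \<open>A\<close>.\<close>
      define D where "D = density lborel (indicator A)"
      have D: "emeasure D B = emeasure lborel (A \<inter> B)" if "B \<in> sets borel" for B
        using that unfolding D_def by (simp add: emeasure_density flip: indicator_inter_arith)
      have "emeasure D A = (SUP K \<in> {K. K \<subseteq> A \<and> compact K}. emeasure D K)"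
        by (rule inner_regular) (use base D[of UNIV] in \<open>auto simp: D_def\<close>)
      moreover have "emeasure D A \<noteq> \<infinity>" using base D[of A] by auto
      moreover have "{K. K \<subseteq> A \<and> compact K} \<noteq> {}" by (auto intro: exI[of _ "{}"])
      ultimately obtain K where K: "K \<subseteq> A" "compact K" "emeasure D A < emeasure D K + ennreal d"
        using SUP_approx_ennreal[of d "{K. K \<subseteq> A \<and> compact K}" "emeasure D A" "emeasure D"] \<open>d > 0\<close>
        by auto
      then have "A \<inter> K = K" by auto
      then show thesis using K D[of A] D[of K] by (intro that[of K]) (auto simp: compact_imp_closed)
    qed
    have [measurable]: "K \<in> sets borel" "U \<in> sets borel"
      using K U by (auto simp: compact_imp_closed)
    have "emeasure lborel K + emeasure lborel (A - K) = emeasure lborel A"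
      using K(2) by (subst plus_emeasure) (auto intro!: arg_cong[where f="emeasure lborel"])
    then have AK: "emeasure lborel (A - K) < ennreal d"
      using K(3) base(2) by (metis ennreal_add_left_cancel_less)
    have fU: "emeasure lborel (U - K) < ennreal (2 * d)"
    proof -
      have "emeasure lborel (U - K) \<le> emeasure lborel ((U - A) \<union> (A - K))"
        by (intro emeasure_mono) auto
      also have "\<dots> \<le> emeasure lborel (U - A) + emeasure lborel (A - K)"
        by (intro emeasure_subadditive) auto
      also have "\<dots> < ennreal d + ennreal d"
        using U AK by (intro add_strict_mono) auto
      finally show ?thesis using \<open>d > 0\<close> by (simp flip: ennreal_plus)
    qed
    then have fin: "emeasure lborel (U - K) < \<infinity>" by (rule order.strict_trans) simp
    have m: "measure lborel (U - K) \<le> 2 * d"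
      using fU \<open>d > 0\<close> by (simp add: measure_def enn2real_leI less_imp_le)
    obtain r where r: "r > 0" "\<And>x y. x \<in> K \<Longrightarrow> y \<in> - U \<Longrightarrow> r \<le> dist x y"
      using separate_compact_closed[of K "- U"] K U by blast
    have "\<forall>\<^sub>F w :: 'a in at 0. norm w < r"
      using \<open>r > 0\<close> by (auto simp: eventually_at intro!: exI[of _ r])
    then show "\<forall>\<^sub>F w in at 0. dist (\<integral>x. norm (indicator A (x - w) *\<^sub>R c - indicator A x *\<^sub>R c) \<partial>lborel) 0 < e"
    proof eventually_elim
      case (elim w)
      have int: "integrable lborel (indicator (U - K) :: 'a \<Rightarrow> real)"
        using fin by (auto simp: integrable_indicator_iff)
      have int': "integrable lborel (\<lambda>x. indicator (U - K) (x - w) :: real)"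
        using int by (subst lborel_integrable_diff) auto
      have intA: "integrable lborel (\<lambda>x. indicator A x *\<^sub>R c)"
        using base by (intro integrable_scaleR_left) (auto simp: integrable_indicator_iff)
      \<comment> \<open>Where the two indicators differ, at least one of \<open>x\<close> and
        \<open>x - w\<close> lies in \<open>U - K\<close>: a point of \<open>K\<close> stays in
        \<open>U\<close> after a shift shorter than \<open>r\<close>.\<close>
      have bnd: "norm (indicator A (x - w) *\<^sub>R c - indicator A x *\<^sub>R c) \<le>
          (indicator (U - K) x + indicator (U - K) (x - w)) * norm c" for x
      proof -
        have "x - w \<in> U" if "x \<in> K" using r(2)[OF that, of "x - w"] elim by (auto simp: dist_norm)
        moreover have "x \<in> U" if "x - w \<in> K" using r(2)[OF that, of x] elim by (auto simp: dist_norm)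
        ultimately show ?thesis using K(2) U(2) by (auto simp: indicator_def)
      qed
      have "(\<integral>x. norm (indicator A (x - w) *\<^sub>R c - indicator A x *\<^sub>R c) \<partial>lborel) \<le>
          (\<integral>x. (indicator (U - K) x + indicator (U - K) (x - w)) * norm c \<partial>lborel)"
        using int int' intA lborel_integrable_diff[of "\<lambda>x. indicator A x *\<^sub>R c" w]
        by (intro integral_mono bnd) auto
      also have "\<dots> = 2 * measure lborel (U - K) * norm c"
        using int int' lborel_integral_diff[of "indicator (U - K) :: 'a \<Rightarrow> real" w] by simp
      also have "\<dots> \<le> 2 * (2 * d) * norm c"
        using m by (intro mult_right_mono mult_left_mono) auto
      also have "\<dots> < e"
        using \<open>e > 0\<close> by (simp add: d_def divide_simps add_nonneg_pos)
      finally show ?case by simp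
    qed
  qed
next
  case (add f g)
  note [measurable] = borel_measurable_integrable[OF add.hyps(1)] borel_measurable_integrable[OF add.hyps(2)]
  have i: "integrable lborel (\<lambda>x. norm (f (x - w) - f x))" "integrable lborel (\<lambda>x. norm (g (x - w) - g x))" for w
    using add.hyps by (auto simp: lborel_integrable_diff)
  have "((\<lambda>w. (\<integral>x. norm (f (x - w) - f x) \<partial>lborel) + (\<integral>x. norm (g (x - w) - g x) \<partial>lborel)) \<longlongrightarrow> 0) (at 0)"
    using tendsto_add[OF add.IH] by simp
  then show ?case
  proof (rule tendsto_0_le[where K=1])
    show "\<forall>\<^sub>F w in at 0. norm (\<integral>x. norm (f (x - w) + g (x - w) - (f x + g x)) \<partial>lborel)
      \<le> norm ((\<integral>x. norm (f (x - w) - f x) \<partial>lborel) + (\<integral>x. norm (g (x - w) - g x) \<partial>lborel)) * 1"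
    proof (intro always_eventually allI)
      fix w
      have "(\<integral>x. norm (f (x - w) + g (x - w) - (f x + g x)) \<partial>lborel)
          \<le> (\<integral>x. norm (f (x - w) - f x) + norm (g (x - w) - g x) \<partial>lborel)"
        using add.hyps i[of w]
        by (intro integral_mono) (auto simp: lborel_integrable_diff add_diff_add norm_triangle_ineq)
      then show "norm (\<integral>x. norm (f (x - w) + g (x - w) - (f x + g x)) \<partial>lborel)
          \<le> norm ((\<integral>x. norm (f (x - w) - f x) \<partial>lborel) + (\<integral>x. norm (g (x - w) - g x) \<partial>lborel)) * 1"
        by (simp add: Bochner_Integration.integral_add i)
    qed
  qed
next
  case (lim f s)
  note [measurable] = borel_measurable_integrable[OF lim.hyps(4)] borel_measurable_integrable[OF lim.hyps(1)]
  have l: "(\<lambda>i. \<integral>x. norm (s i x - f x) \<partial>lborel) \<longlonglongrightarrow> (\<integral>x. norm (0::'b) \<partial>(lborel :: 'a measure))"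
  \<comment> \<open>The factor \<open>3\<close> is \<open>2 + 1\<close>: the approximating simple
    functions satisfy \<open>norm (s i x) \<le> 2 * norm (f x)\<close>.\<close>
  proof (rule integral_dominated_convergence[where w="\<lambda>x. 3 * norm (f x)"])
    show "AE x in lborel. (\<lambda>i. norm (s i x - f x)) \<longlonglongrightarrow> norm (0::'b)"
      using lim.hyps(2) by (intro AE_I2 tendsto_norm) (simp add: LIM_zero_iff)
    show "AE x in lborel. norm (norm (s i x - f x)) \<le> 3 * norm (f x)" for i
    proof (rule AE_I2)
      fix x show "norm (norm (s i x - f x)) \<le> 3 * norm (f x)"
        using norm_triangle_ineq4[of "s i x" "f x"] lim.hyps(3)[of x i] by simp
    qed
  qed (use lim.hyps(4) in auto)
  show ?case
  proof (rule tendstoI)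
    fix e :: real assume "e > 0"
    have "\<forall>\<^sub>F i in sequentially. (\<integral>x. norm (s i x - f x) \<partial>lborel) < e / 3"
      using order_tendstoD(2)[OF l, of "e / 3"] \<open>e > 0\<close> by simp
    then obtain i where i: "(\<integral>x. norm (s i x - f x) \<partial>lborel) < e / 3"
      using eventually_happens'[OF sequentially_bot] by blast
    have "\<forall>\<^sub>F w in at 0. (\<integral>x. norm (s i (x - w) - s i x) \<partial>lborel) < e / 3"
      using order_tendstoD(2)[OF lim.IH[of i], of "e / 3"] \<open>e > 0\<close> by simp
    then show "\<forall>\<^sub>F w in at 0. dist (\<integral>x. norm (f (x - w) - f x) \<partial>lborel) 0 < e"
    proof eventually_elim
      case (elim w)
      have int: "integrable lborel (\<lambda>x. norm (s i (x - w) - f (x - w)))"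
        "integrable lborel (\<lambda>x. norm (s i (x - w) - s i x))" "integrable lborel (\<lambda>x. norm (s i x - f x))"
        using lim.hyps(1)[of i] lim.hyps(4) by (auto simp: lborel_integrable_diff)
      have tr: "norm (f (x - w) - f x) \<le> norm (s i (x - w) - f (x - w)) + norm (s i (x - w) - s i x) + norm (s i x - f x)" for x
        by norm
      have "(\<integral>x. norm (f (x - w) - f x) \<partial>lborel) \<le>
         (\<integral>x. norm (s i (x - w) - f (x - w)) + norm (s i (x - w) - s i x) + norm (s i x - f x) \<partial>lborel)"
        using lim.hyps(4) int by (intro integral_mono tr) (auto simp: lborel_integrable_diff)
      also have "\<dots> = (\<integral>x. norm (s i (x - w) - f (x - w)) \<partial>lborel) +
          (\<integral>x. norm (s i (x - w) - s i x) \<partial>lborel) + (\<integral>x. norm (s i x - f x) \<partial>lborel)"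
        using int by simp
      also have "(\<integral>x. norm (s i (x - w) - f (x - w)) \<partial>lborel) = (\<integral>x. norm (s i x - f x) \<partial>lborel)"
        by (rule lborel_integral_diff[of "\<lambda>x. norm (s i x - f x)"]) simp
      finally show ?case using elim i by simp
    qed
  qed
qed

section \<open>Plancherel's inequality\<close>

text \<open>The unitary normalisation is left out here and enters only when this integral is
  compared with \<open>truncated_fourier\<close>; hence the powers of \<open>2 * pi\<close>
  below.\<close>

definition L1_fourier :: "('a::euclidean_space \<Rightarrow> complex) \<Rightarrow> 'a \<Rightarrow> complex" where
  "L1_fourier f \<xi> = (\<integral>x. cis (- (\<xi> \<bullet> x)) * f x \<partial>lborel)"

lemma borel_measurable_L1_fourier [measurable]:
  assumes [measurable]: "f \<in> borel_measurable borel"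
  shows "L1_fourier f \<in> borel_measurable borel"
  unfolding L1_fourier_def by measurable

lemma integrable_cis_mult:
  fixes f :: "'a::euclidean_space \<Rightarrow> complex"
  assumes "integrable lborel f"
  shows "integrable lborel (\<lambda>x. cis (- (\<xi> \<bullet> x)) * f x)"
  by (rule Bochner_Integration.integrable_bound[OF assms])
    (use borel_measurable_integrable[OF assms] in \<open>auto simp: norm_mult\<close>)

text \<open>Moving the Fourier transform onto the Gaussian avoids the inversion formula.\<close>

lemma L1_fourier_gauss:
  fixes f :: "'a::euclidean_space \<Rightarrow> complex"
  assumes f: "integrable lborel f"
  shows "(\<integral>\<xi>. L1_fourier f \<xi> * gauss \<xi> \<partial>lborel) = sqrt (2 * pi) ^ DIM('a) * (\<integral>x. f x * gauss x \<partial>lborel)"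
proof -
  note [measurable] = borel_measurable_integrable[OF f]
  define g where "g \<xi> x = cis (- (\<xi> \<bullet> x)) * f x * complex_of_real (gauss \<xi>)" for \<xi> x :: 'a
  have "integrable (lborel \<Otimes>\<^sub>M lborel) (case_prod g)"
  proof (rule lborel_pair.Fubini_integrable)
    show "case_prod g \<in> borel_measurable (lborel \<Otimes>\<^sub>M lborel)" unfolding g_def by measurable
    show "integrable lborel (\<lambda>\<xi>. \<integral>x. norm (case_prod g (\<xi>, x)) \<partial>lborel)"
      by (simp add: g_def norm_mult gauss_pos less_imp_le integrable_gauss)
    show "AE \<xi> in lborel. integrable lborel (\<lambda>x. case_prod g (\<xi>, x))"
      by (intro AE_I2) (simp add: g_def integrable_cis_mult f)
  qed
  then have "(\<integral>x. \<integral>\<xi>. g \<xi> x \<partial>lborel \<partial>lborel) = (\<integral>\<xi>. \<integral>x. g \<xi> x \<partial>lborel \<partial>lborel)"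
    by (rule lborel_pair.Fubini_integral)
  moreover have "(\<integral>\<xi>. g \<xi> x \<partial>lborel) = sqrt (2 * pi) ^ DIM('a) * (f x * gauss x)" for x
  proof -
    have "(\<integral>\<xi>. g \<xi> x \<partial>lborel) = (\<integral>\<xi>. f x * (cis (- (\<xi> \<bullet> x)) * complex_of_real (gauss \<xi>)) \<partial>lborel)"
      by (simp add: g_def mult_ac)
    then show ?thesis by (simp add: integral_gauss_fourier)
  qed
  moreover have "(\<integral>x. g \<xi> x \<partial>lborel) = L1_fourier f \<xi> * gauss \<xi>" for \<xi>
    by (simp add: g_def L1_fourier_def)
  ultimately show ?thesis by simp
qed

text \<open>The convolution of \<open>f\<close> with its reflected conjugate. It links the two sides
  of Plancherel: its value at \<open>0\<close> is the squared norm of \<open>f\<close>, and its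
  transform is the squared modulus of the transform of \<open>f\<close>.\<close>

definition autocorrelation :: "('a::euclidean_space \<Rightarrow> complex) \<Rightarrow> 'a \<Rightarrow> complex" where
  "autocorrelation f w = (\<integral>x. f x * cnj (f (x - w)) \<partial>lborel)"

lemma norm_mult_le_sum_squares: "norm (a * b) \<le> (norm a)\<^sup>2 + (norm b)\<^sup>2" for a b :: complex
proof -
  have "0 \<le> (norm a - norm b)\<^sup>2" by simp
  then have "2 * (norm a * norm b) \<le> (norm a)\<^sup>2 + (norm b)\<^sup>2" by (simp add: power2_diff)
  moreover have "0 \<le> norm a * norm b" by simp
  ultimately show ?thesis unfolding norm_mult by linarith
qed

lemma autocorrelation_0: "autocorrelation f 0 = (\<integral>x. (norm (f x))\<^sup>2 \<partial>lborel)"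
  by (simp add: autocorrelation_def complex_norm_square[symmetric] flip: of_real_power)

context
  fixes f :: "'a::euclidean_space \<Rightarrow> complex"
  assumes f1: "integrable lborel f" and f2: "integrable lborel (\<lambda>x. (norm (f x))\<^sup>2)"
begin

lemma borel_measurable_f [measurable]: "f \<in> borel_measurable borel"
  using borel_measurable_integrable[OF f1] by simp

lemma integrable_translate_square: "integrable lborel (\<lambda>x. (norm (f (x - w)))\<^sup>2)"
  using f2 lborel_integrable_diff[of "\<lambda>x. (norm (f x))\<^sup>2" w] by simp

lemma integral_translate_square: "(\<integral>x. (norm (f (x - w)))\<^sup>2 \<partial>lborel) = (\<integral>x. (norm (f x))\<^sup>2 \<partial>lborel)"
  using lborel_integral_diff[of "\<lambda>x. (norm (f x))\<^sup>2" w] by simp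

lemma integrable_autocorrelation_integrand: "integrable lborel (\<lambda>x. f x * cnj (f (x - w)))"
  by (rule Bochner_Integration.integrable_bound[OF
        Bochner_Integration.integrable_add[OF f2 integrable_translate_square[of w]]])
    (auto intro!: AE_I2 order_trans[OF norm_mult_le_sum_squares])

text \<open>The factor \<open>2\<close> comes from bounding a product by the sum of the squares.
  What matters is uniformity in \<open>w\<close>, which supplies a dominating function for the
  Gaussian means below.\<close>

lemma norm_autocorrelation_le: "norm (autocorrelation f w) \<le> 2 * (\<integral>x. (norm (f x))\<^sup>2 \<partial>lborel)"
proof -
  have "norm (autocorrelation f w) \<le> (\<integral>x. norm (f x * cnj (f (x - w))) \<partial>lborel)"
    unfolding autocorrelation_def by (rule integral_norm_bound)
  also have "\<dots> \<le> (\<integral>x. (norm (f x))\<^sup>2 + (norm (f (x - w)))\<^sup>2 \<partial>lborel)"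
    using integrable_autocorrelation_integrand[of w] f2 integrable_translate_square[of w] norm_mult_le_sum_squares[of "f _" "cnj (f (_ - w))"]
    by (intro integral_mono) auto
  also have "\<dots> = 2 * (\<integral>x. (norm (f x))\<^sup>2 \<partial>lborel)"
    using f2 integrable_translate_square[of w] by (simp add: integral_translate_square)
  finally show ?thesis .
qed

text \<open>The convolution theorem by Fubini: for fixed \<open>x\<close>, the substitution of
  \<open>x - w\<close> for \<open>w\<close> turns the inner integral into the conjugate transform of
  \<open>f\<close>.\<close>

lemma
  shows integrable_autocorrelation: "integrable lborel (autocorrelation f)"
    and L1_fourier_autocorrelation: "L1_fourier (autocorrelation f) \<xi> = (norm (L1_fourier f \<xi>))\<^sup>2"
proof -
  define g where "g \<xi> x w = cis (- (\<xi> \<bullet> w)) * (f x * cnj (f (x - w)))" for \<xi> x w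
  have "integrable (lborel \<Otimes>\<^sub>M lborel) (case_prod (g \<xi>))" for \<xi>
  proof (rule lborel_pair.Fubini_integrable)
    show "case_prod (g \<xi>) \<in> borel_measurable (lborel \<Otimes>\<^sub>M lborel)" unfolding g_def by measurable
    have "(\<integral>w. norm (g \<xi> x w) \<partial>lborel) = norm (f x) * (\<integral>w. norm (f w) \<partial>lborel)" for x
      using lborel_integral_diff_left[of "\<lambda>x. norm (f x)" x] by (simp add: g_def norm_mult)
    then show "integrable lborel (\<lambda>x. \<integral>w. norm (case_prod (g \<xi>) (x, w)) \<partial>lborel)"
      using f1 by simp
    show "AE x in lborel. integrable lborel (\<lambda>w. case_prod (g \<xi>) (x, w))"
    proof (rule AE_I2)
      fix x
      have "integrable lborel (\<lambda>w. f (x - w))"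
        using f1 by (subst lborel_integrable_diff_left) auto
      then show "integrable lborel (\<lambda>w. case_prod (g \<xi>) (x, w))"
        by (simp add: g_def integrable_cis_mult)
    qed
  qed
  note G = this
  have gw: "(\<integral>x. g \<xi> x w \<partial>lborel) = cis (- (\<xi> \<bullet> w)) * autocorrelation f w" for \<xi> w
    by (simp add: g_def autocorrelation_def)
  \<comment> \<open>At frequency \<open>0\<close> the phase is \<open>1\<close>, so integrability of
    the marginal is integrability of the autocorrelation itself.\<close>
  show "integrable lborel (autocorrelation f)"
    using lborel_pair.integrable_snd[OF G[of 0]] by (simp add: gw)
  have gx: "(\<integral>w. g \<xi> x w \<partial>lborel) = cis (- (\<xi> \<bullet> x)) * f x * cnj (L1_fourier f \<xi>)" for x
  proof -
    \<comment> \<open>The phase in \<open>w\<close> splits into the phase in \<open>x\<close> times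
      the conjugate of the phase in \<open>x - w\<close>.\<close>
    have "(\<integral>w. g \<xi> x w \<partial>lborel) =
        (\<integral>w. cis (- (\<xi> \<bullet> x)) * f x * cnj (cis (- (\<xi> \<bullet> (x - w))) * f (x - w)) \<partial>lborel)"
      by (intro Bochner_Integration.integral_cong refl)
        (simp add: g_def cis_cnj cis_mult[symmetric] inner_diff_right mult_ac cis_divide[symmetric] flip: cis_inverse)
    also have "\<dots> = cis (- (\<xi> \<bullet> x)) * f x * cnj (\<integral>w. cis (- (\<xi> \<bullet> (x - w))) * f (x - w) \<partial>lborel)"
      by (simp only: integral_mult_right_zero Bochner_Integration.integral_cnj)
    also have "(\<integral>w. cis (- (\<xi> \<bullet> (x - w))) * f (x - w) \<partial>lborel) = L1_fourier f \<xi>"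
      unfolding L1_fourier_def by (rule lborel_integral_diff_left[of "\<lambda>w. cis (- (\<xi> \<bullet> w)) * f w"]) measurable
    finally show ?thesis .
  qed
  have "L1_fourier (autocorrelation f) \<xi> = (\<integral>w. \<integral>x. g \<xi> x w \<partial>lborel \<partial>lborel)"
    by (simp add: gw L1_fourier_def)
  also have "\<dots> = (\<integral>x. \<integral>w. g \<xi> x w \<partial>lborel \<partial>lborel)"
    by (rule lborel_pair.Fubini_integral[OF G])
  also have "\<dots> = L1_fourier f \<xi> * cnj (L1_fourier f \<xi>)"
    by (simp add: gx L1_fourier_def)
  finally show "L1_fourier (autocorrelation f) \<xi> = (norm (L1_fourier f \<xi>))\<^sup>2"
    by (simp only: complex_norm_square)
qed

text \<open>Continuity of translations is known here in \<open>L^1\<close> only. Where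
  \<open>f\<close> is bounded by a height \<open>n\<close> this suffices, since the factor
  \<open>f x\<close> costs at most that height; the part of \<open>f\<close> above it is small in
  \<open>L^2\<close> and is handled by a weighted form of Young's inequality.\<close>

lemma tendsto_autocorrelation_0: "(autocorrelation f \<longlongrightarrow> autocorrelation f 0) (at 0)"
proof (rule tendstoI)
  fix e :: real assume "e > 0"
  define S where "S = (\<integral>x. (norm (f x))\<^sup>2 \<partial>lborel)"
  have "S \<ge> 0" by (simp add: S_def)
  \<comment> \<open>The weight is chosen so that the terms divided by \<open>s\<close> contribute
    \<open>S / s\<close>, at most \<open>e / 3\<close>. The tail threshold
    \<open>e / (6 * s)\<close> and the shift threshold \<open>e / (3 * M)\<close> supply the other
    two thirds.\<close>
  define s where "s = 3 * (S + 1) / e"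
  have "s > 0" using \<open>e > 0\<close> \<open>S \<ge> 0\<close> by (simp add: s_def)
  \<comment> \<open>The part of \<open>f\<close> that exceeds the height \<open>M\<close>.\<close>
  define r where "r M x = (if norm (f x) \<le> M then 0 else f x)" for M x
  have [measurable]: "r M \<in> borel_measurable borel" for M unfolding r_def by measurable
  have "(\<lambda>n. \<integral>x. (norm (r (real n) x))\<^sup>2 \<partial>lborel) \<longlonglongrightarrow> (\<integral>x. 0 \<partial>(lborel :: 'a measure))"
  proof (rule integral_dominated_convergence[OF _ _ f2])
    show "AE x in lborel. (\<lambda>n. (norm (r (real n) x))\<^sup>2) \<longlonglongrightarrow> 0"
    proof (rule AE_I2)
      fix x
      have "\<forall>\<^sub>F n in sequentially. (norm (r (real n) x))\<^sup>2 = 0"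
        using eventually_ge_at_top[of "nat \<lceil>norm (f x)\<rceil>"]
        by eventually_elim (auto simp: r_def nat_le_iff ceiling_le_iff)
      then show "(\<lambda>n. (norm (r (real n) x))\<^sup>2) \<longlonglongrightarrow> 0" by (rule tendsto_eventually)
    qed
    show "AE x in lborel. norm ((norm (r (real n) x))\<^sup>2) \<le> (norm (f x))\<^sup>2" for n
      by (auto simp: r_def)
  qed auto
  then have "\<forall>\<^sub>F n in sequentially. (\<integral>x. (norm (r (real n) x))\<^sup>2 \<partial>lborel) < e / (6 * s)"
    using \<open>e > 0\<close> \<open>s > 0\<close> by (intro order_tendstoD(2)) auto
  then obtain n where n: "(\<integral>x. (norm (r (real n) x))\<^sup>2 \<partial>lborel) < e / (6 * s)"
    using eventually_happens'[OF sequentially_bot] by blast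
  \<comment> \<open>Adding one keeps the divisor positive when \<open>n = 0\<close>.\<close>
  define M where "M = real n + 1"
  have r2: "integrable lborel (\<lambda>x. (norm (r (real n) x))\<^sup>2)"
    by (rule Bochner_Integration.integrable_bound[OF f2]) (auto simp: r_def)
  have "M > 0" by (simp add: M_def)
  have "\<forall>\<^sub>F w in at 0. (\<integral>x. norm (f (x - w) - f x) \<partial>lborel) < e / (3 * M)"
    using order_tendstoD(2)[OF L1_translation_continuous[OF f1], of "e / (3 * M)"] \<open>e > 0\<close> \<open>M > 0\<close> by simp
  then show "\<forall>\<^sub>F w in at 0. dist (autocorrelation f w) (autocorrelation f 0) < e"
  proof eventually_elim
    case (elim w)
    define R where "R x = (norm (r (real n) x))\<^sup>2" for x
    have pt: "norm (f x * cnj (f (x - w)) - f x * cnj (f x)) \<le>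
        M * norm (f (x - w) - f x) + (2 * s * R x + (1 / (2 * s)) * ((norm (f (x - w)))\<^sup>2 + (norm (f x))\<^sup>2))" for x
    proof -
      have "norm (f x * cnj (f (x - w)) - f x * cnj (f x)) = norm (f x) * norm (f (x - w) - f x)"
        by (metis complex_cnj_diff complex_mod_cnj norm_mult right_diff_distrib)
      also have "\<dots> \<le> M * norm (f (x - w) - f x) + (2 * s * R x + (1 / (2 * s)) * ((norm (f (x - w)))\<^sup>2 + (norm (f x))\<^sup>2))"
      proof (cases "norm (f x) \<le> real n")
        case True
        then have "norm (f x) * norm (f (x - w) - f x) \<le> M * norm (f (x - w) - f x)"
          by (intro mult_right_mono) (auto simp: M_def)
        moreover have "0 \<le> 2 * s * R x + (1 / (2 * s)) * ((norm (f (x - w)))\<^sup>2 + (norm (f x))\<^sup>2)"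
          using \<open>s > 0\<close> by (simp add: R_def)
        ultimately show ?thesis by linarith
      next
        case False
        have am: "a * b \<le> s * a\<^sup>2 + (1 / (2 * s)) * b\<^sup>2" if "a \<ge> 0" for a b :: real
        proof -
          have "0 \<le> (1 / (2 * s)) * ((s * a - b)\<^sup>2 + (s * a)\<^sup>2)" using \<open>s > 0\<close> by simp
          also have "\<dots> = s * a\<^sup>2 + (1 / (2 * s)) * b\<^sup>2 - a * b"
            using \<open>s > 0\<close> by (simp add: power2_eq_square field_simps)
          finally show ?thesis by simp
        qed
        have "norm (f x) * norm (f (x - w) - f x) \<le> norm (f x) * (norm (f (x - w)) + norm (f x))"
          by (intro mult_left_mono norm_triangle_ineq4) auto
        also have "\<dots> \<le> 2 * s * (norm (f x))\<^sup>2 + (1 / (2 * s)) * ((norm (f (x - w)))\<^sup>2 + (norm (f x))\<^sup>2)"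
          using am[of "norm (f x)" "norm (f (x - w))"] am[of "norm (f x)" "norm (f x)"]
          by (simp add: algebra_simps)
        also have "\<dots> = 2 * s * R x + (1 / (2 * s)) * ((norm (f (x - w)))\<^sup>2 + (norm (f x))\<^sup>2)"
          using False by (simp add: R_def r_def)
        finally show ?thesis using \<open>M > 0\<close> by (simp add: add_increasing)
      qed
      finally show ?thesis .
    qed
    have i1: "integrable lborel (\<lambda>x. f (x - w) - f x)"
      using f1 by (auto simp: lborel_integrable_diff)
    have i2: "integrable lborel R" using r2 by (simp add: R_def[abs_def])
    have int: "integrable lborel (\<lambda>x. f x * cnj (f (x - w)) - f x * cnj (f x))"
      using integrable_autocorrelation_integrand[of w] integrable_autocorrelation_integrand[of 0] by simp
    have "dist (autocorrelation f w) (autocorrelation f 0) =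
        norm (\<integral>x. f x * cnj (f (x - w)) - f x * cnj (f x) \<partial>lborel)"
      unfolding dist_norm autocorrelation_def
      using integrable_autocorrelation_integrand[of w] integrable_autocorrelation_integrand[of 0] by simp
    also have "\<dots> \<le> (\<integral>x. norm (f x * cnj (f (x - w)) - f x * cnj (f x)) \<partial>lborel)"
      by (rule integral_norm_bound)
    also have "\<dots> \<le> (\<integral>x. M * norm (f (x - w) - f x) + (2 * s * R x + (1 / (2 * s)) * ((norm (f (x - w)))\<^sup>2 + (norm (f x))\<^sup>2)) \<partial>lborel)"
      using int i1 i2 f2 integrable_translate_square[of w] by (intro integral_mono pt) auto
    also have "\<dots> = M * (\<integral>x. norm (f (x - w) - f x) \<partial>lborel) + (2 * s * (\<integral>x. R x \<partial>lborel) + (1 / (2 * s)) * (S + S))"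
      using i1 i2 f2 integrable_translate_square[of w]
      by (simp add: integral_translate_square S_def add_divide_distrib)
    also have "\<dots> < e"
    proof -
      have "M * (\<integral>x. norm (f (x - w) - f x) \<partial>lborel) < e / 3"
        using elim \<open>M > 0\<close> by (simp add: field_simps)
      moreover have "2 * s * (\<integral>x. R x \<partial>lborel) < e / 3"
        using n \<open>s > 0\<close> by (simp add: R_def field_simps)
      moreover have "(1 / (2 * s)) * (S + S) \<le> e / 3"
        using \<open>S \<ge> 0\<close> \<open>e > 0\<close> by (simp add: s_def field_simps)
      ultimately show ?thesis by linarith
    qed
    finally show ?case .
  qed
qed

text \<open>Gaussian summation: average the autocorrelation over a Gaussian of width
  \<open>d\<close> and move the transform onto the Gaussian. The average becomes an integral of the
  squared modulus of the transform against a weight at most \<open>1\<close>. As \<open>d\<close>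
  tends to \<open>0\<close>, continuity at the origin turns the average into the squared norm of
  \<open>f\<close>.\<close>

lemma plancherel_L1_L2_le:
  assumes F2: "integrable lborel (\<lambda>\<xi>. (norm (L1_fourier f \<xi>))\<^sup>2)"
  shows "(2 * pi) ^ DIM('a) * (\<integral>x. (norm (f x))\<^sup>2 \<partial>lborel) \<le> (\<integral>\<xi>. (norm (L1_fourier f \<xi>))\<^sup>2 \<partial>lborel)"
proof -
  let ?a = "autocorrelation f"
  have [measurable]: "?a \<in> borel_measurable borel"
    using borel_measurable_integrable[OF integrable_autocorrelation] by simp
  define I where "I = (\<integral>\<xi>. (norm (L1_fourier f \<xi>))\<^sup>2 \<partial>lborel)"
  define c where "c = sqrt (2 * pi) ^ DIM('a)"
  have le: "c * Re (\<integral>x. ?a (d *\<^sub>R x) * gauss x \<partial>lborel) \<le> I" if d: "d > 0" for d :: real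
  proof -
    have ad: "integrable lborel (\<lambda>x. ?a (d *\<^sub>R x))"
      using d integrable_autocorrelation by (subst lborel_integrable_scale) auto
    \<comment> \<open>Contracting in space dilates in frequency, and the transform of the
      autocorrelation is already known as a square.\<close>
    have Fd: "d ^ DIM('a) * L1_fourier (\<lambda>x. ?a (d *\<^sub>R x)) \<xi> = (norm (L1_fourier f (\<xi> /\<^sub>R d)))\<^sup>2" for \<xi>
    proof -
      have "L1_fourier ?a (\<xi> /\<^sub>R d) =
          d ^ DIM('a) *\<^sub>R (\<integral>x. cis (- ((\<xi> /\<^sub>R d) \<bullet> (d *\<^sub>R x))) * ?a (d *\<^sub>R x) \<partial>lborel)"
        unfolding L1_fourier_def using d by (subst lborel_integral_scale[of d]) auto
      also have "(\<lambda>x. cis (- ((\<xi> /\<^sub>R d) \<bullet> (d *\<^sub>R x))) * ?a (d *\<^sub>R x)) = (\<lambda>x. cis (- (\<xi> \<bullet> x)) * ?a (d *\<^sub>R x))"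
        using d by (simp add: mult.assoc[symmetric])
      finally show ?thesis
        using L1_fourier_autocorrelation[of "\<xi> /\<^sub>R d"] by (simp add: L1_fourier_def scaleR_conv_of_real)
    qed
    define h where "h \<xi> = (norm (L1_fourier f (\<xi> /\<^sub>R d)))\<^sup>2" for \<xi>
    have [measurable]: "h \<in> borel_measurable borel" unfolding h_def by measurable
    have h: "integrable lborel h"
      unfolding h_def using d F2 lborel_integrable_scale[of "inverse d" "\<lambda>\<xi>. (norm (L1_fourier f \<xi>))\<^sup>2"] by simp
    have hI: "I = inverse d ^ DIM('a) * (\<integral>\<xi>. h \<xi> \<partial>lborel)"
      unfolding I_def h_def using d by (subst lborel_integral_scale[of "inverse d"]) auto
    have hg: "integrable lborel (\<lambda>\<xi>. h \<xi> * gauss \<xi>)"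
      by (rule Bochner_Integration.integrable_bound[OF h])
        (auto simp: abs_mult h_def gauss_pos gauss_le_1 less_imp_le mult_left_le)
    have "d ^ DIM('a) * (\<integral>\<xi>. L1_fourier (\<lambda>x. ?a (d *\<^sub>R x)) \<xi> * gauss \<xi> \<partial>lborel) =
        (\<integral>\<xi>. d ^ DIM('a) * L1_fourier (\<lambda>x. ?a (d *\<^sub>R x)) \<xi> * gauss \<xi> \<partial>lborel)"
      by (simp add: mult.assoc)
    also have "\<dots> = complex_of_real (\<integral>\<xi>. h \<xi> * gauss \<xi> \<partial>lborel)"
      by (simp add: Fd h_def flip: of_real_mult of_real_power)
    finally have "complex_of_real (d ^ DIM('a) * c) * (\<integral>x. ?a (d *\<^sub>R x) * gauss x \<partial>lborel) =
        complex_of_real (\<integral>\<xi>. h \<xi> * gauss \<xi> \<partial>lborel)"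
      by (simp add: L1_fourier_gauss[OF ad] c_def mult.assoc)
    from arg_cong[OF this, of Re]
    have "d ^ DIM('a) * (c * Re (\<integral>x. ?a (d *\<^sub>R x) * gauss x \<partial>lborel)) = (\<integral>\<xi>. h \<xi> * gauss \<xi> \<partial>lborel)"
      by (simp add: mult.assoc)
    \<comment> \<open>Dropping the Gaussian weight is the only loss, and it makes the bound
      independent of \<open>d\<close>.\<close>
    also have "\<dots> \<le> (\<integral>\<xi>. h \<xi> \<partial>lborel)"
    proof (intro integral_mono h hg)
      show "h \<xi> * gauss \<xi> \<le> h \<xi>" for \<xi>
        by (simp add: h_def gauss_le_1 mult_left_le)
    qed
    also have "\<dots> = d ^ DIM('a) * I" using d by (simp add: hI power_inverse)
    finally show ?thesis using d by simp
  qed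
  define \<delta> where "\<delta> n = inverse (real (Suc n))" for n
  have \<delta>: "\<delta> n > 0" for n by (simp add: \<delta>_def)
  have \<delta>0: "\<delta> \<longlonglongrightarrow> 0" unfolding \<delta>_def by (rule LIMSEQ_inverse_real_of_nat)
  define S where "S = (\<integral>x. (norm (f x))\<^sup>2 \<partial>lborel)"
  have "(\<lambda>n. \<integral>x. ?a (\<delta> n *\<^sub>R x) * gauss x \<partial>lborel) \<longlonglongrightarrow> (\<integral>x. ?a 0 * gauss x \<partial>(lborel :: 'a measure))"
  proof (rule integral_dominated_convergence[where w="\<lambda>x :: 'a. 2 * S * gauss x"])
    show "AE x in lborel. (\<lambda>n. ?a (\<delta> n *\<^sub>R x) * complex_of_real (gauss x)) \<longlonglongrightarrow> ?a 0 * complex_of_real (gauss x)"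
    proof (rule AE_I2)
      fix x :: 'a
      have "isCont ?a 0" using tendsto_autocorrelation_0 by (simp add: isCont_def)
      moreover have "(\<lambda>n. \<delta> n *\<^sub>R x) \<longlonglongrightarrow> 0" using tendsto_scaleR[OF \<delta>0 tendsto_const[of x]] by simp
      ultimately have "(\<lambda>n. ?a (\<delta> n *\<^sub>R x)) \<longlonglongrightarrow> ?a 0" by (rule isCont_tendsto_compose)
      then show "(\<lambda>n. ?a (\<delta> n *\<^sub>R x) * complex_of_real (gauss x)) \<longlonglongrightarrow> ?a 0 * complex_of_real (gauss x)"
        by (intro tendsto_mult tendsto_const)
    qed
    show "AE x in lborel. norm (?a (\<delta> n *\<^sub>R x) * complex_of_real (gauss x)) \<le> 2 * S * gauss x" for n
      using norm_autocorrelation_le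
      by (intro AE_I2) (simp add: norm_mult gauss_pos less_imp_le S_def mult_right_mono)
  qed (auto simp: integrable_gauss)
  \<comment> \<open>The Gaussian mass gives a second factor \<open>c\<close> besides the one from
    moving the transform; together they form \<open>(2 * pi) ^ DIM('a)\<close>.\<close>
  moreover have "(\<integral>x. ?a 0 * gauss x \<partial>(lborel :: 'a measure)) = complex_of_real (S * c)"
    by (simp add: autocorrelation_0 S_def c_def integral_gauss)
  ultimately have "(\<lambda>n. c * Re (\<integral>x. ?a (\<delta> n *\<^sub>R x) * gauss x \<partial>lborel)) \<longlonglongrightarrow> c * Re (complex_of_real (S * c))"
    by (intro tendsto_mult tendsto_const tendsto_Re) simp
  then have "c * Re (complex_of_real (S * c)) \<le> I"
    by (rule LIMSEQ_le_const2) (use le \<delta> in auto)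
  then have "(c * c) * S \<le> I" by (simp add: mult_ac)
  moreover have "c * c = (2 * pi) ^ DIM('a)"
    unfolding c_def power_mult_distrib[symmetric] by simp
  ultimately show ?thesis by (simp only: S_def I_def)
qed

end

section \<open>From scalar integrable functions to vector-valued truncated transforms\<close>

lemma bounded_bilinear_vector_scalar_mult:
  "bounded_bilinear ((*s) :: complex \<Rightarrow> complex^'n \<Rightarrow> complex^'n)"
proof -
  have "bilinear ((*s) :: complex \<Rightarrow> complex^'n \<Rightarrow> complex^'n)"
    unfolding bilinear_def by (auto intro!: linearI simp: vec_eq_iff algebra_simps)
  then show ?thesis by (simp add: bilinear_conv_bounded_bilinear)
qed

lemma norm_vector_scalar_mult: "norm (c *s v) = norm c * norm (v :: complex^'n)"
  by (simp add: norm_vec_def norm_mult L2_set_right_distrib)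

lemma borel_measurable_vector_scalar_mult [measurable]:
  fixes g :: "'a \<Rightarrow> complex^'n"
  assumes "f \<in> borel_measurable M" "g \<in> borel_measurable M"
  shows "(\<lambda>x. f x *s g x) \<in> borel_measurable M"
  using assms
  by (rule borel_measurable_continuous_Pair)
    (intro bounded_bilinear.continuous_on[OF bounded_bilinear_vector_scalar_mult] continuous_intros)

lemma borel_measurable_vec_nth_comp [measurable]:
  fixes f :: "'a \<Rightarrow> complex^'n"
  shows "f \<in> borel_measurable M \<Longrightarrow> (\<lambda>x. f x $ i) \<in> borel_measurable M"
  by (rule borel_measurable_continuous_on[where f="\<lambda>v. v $ i"]) (auto intro!: continuous_intros)

lemma borel_measurable_cball_cutoff [measurable]:
  fixes f :: "'a::euclidean_space \<Rightarrow> 'b::euclidean_space"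
  assumes "f \<in> borel_measurable borel"
  shows "(\<lambda>x. indicator (cball 0 R) x *\<^sub>R f x) \<in> borel_measurable borel"
  using assms by (intro borel_measurable_scaleR borel_measurable_indicator) auto

lemma square_integrable_borel: "square_integrable f \<Longrightarrow> f \<in> borel_measurable borel"
  by (simp add: square_integrable_def)

lemma norm_add_square_le: "(norm (a + b))\<^sup>2 \<le> 2 * (norm a)\<^sup>2 + 2 * (norm (b::'a::real_normed_vector))\<^sup>2"
proof -
  have "(norm (a + b))\<^sup>2 \<le> (norm a + norm b)\<^sup>2" by (intro power_mono norm_triangle_ineq) auto
  also have "\<dots> \<le> (norm a + norm b)\<^sup>2 + (norm a - norm b)\<^sup>2" by simp
  also have "\<dots> = 2 * (norm a)\<^sup>2 + 2 * (norm b)\<^sup>2" by (simp add: power2_eq_square algebra_simps)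
  finally show ?thesis .
qed

lemma square_integrable_diff:
  assumes "square_integrable f" "square_integrable g"
  shows "square_integrable (\<lambda>x. f x - g x)"
proof -
  have [measurable]: "f \<in> borel_measurable borel" "g \<in> borel_measurable borel"
    using assms by (auto simp: square_integrable_def)
  have "integrable lborel (\<lambda>x. 2 * (norm (f x))\<^sup>2 + 2 * (norm (g x))\<^sup>2)"
    using assms by (auto simp: square_integrable_def)
  then have "integrable lborel (\<lambda>x. (norm (f x - g x))\<^sup>2)"
    by (rule Bochner_Integration.integrable_bound)
      (use norm_add_square_le[of "f _" "- g _"] in auto)
  then show ?thesis by (simp add: square_integrable_def)
qed

text \<open>On a ball, which has finite measure, \<open>norm (f x) \<le> 1 + (norm (f x))^2\<close>
  makes a square-integrable function integrable as well. The cut-off thus meets both assumptions of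
  the scalar Plancherel inequality.\<close>

lemma square_integrable_indicator_cball:
  fixes f :: "real^'d \<Rightarrow> complex^'n"
  assumes "square_integrable f"
  shows "integrable lborel (\<lambda>x. indicator (cball 0 R) x *\<^sub>R f x)"
    and "integrable lborel (\<lambda>x. (norm (indicator (cball 0 R) x *\<^sub>R f x))\<^sup>2)"
proof -
  have [measurable]: "f \<in> borel_measurable borel" using assms by (rule square_integrable_borel)
  have f2: "integrable lborel (\<lambda>x. (norm (f x))\<^sup>2)" using assms by (simp add: square_integrable_def)
  have "emeasure lborel (cball (0 :: real^'d) R) < \<infinity>" by (rule emeasure_compact_finite) simp
  then have "integrable lborel (\<lambda>x. indicator (cball (0 :: real^'d) R) x + (norm (f x))\<^sup>2)"
    using f2 by (auto simp: integrable_indicator_iff)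
  then show "integrable lborel (\<lambda>x. indicator (cball 0 R) x *\<^sub>R f x)"
  proof (rule Bochner_Integration.integrable_bound)
    have "norm (f x) \<le> 1 + (norm (f x))\<^sup>2" for x
      using zero_le_power2[of "norm (f x) - 1/2"] by (simp add: power2_diff power_divide)
    then show "AE x in lborel. norm (indicator (cball 0 R) x *\<^sub>R f x) \<le>
        norm (indicator (cball (0 :: real^'d) R) x + (norm (f x))\<^sup>2)"
      by (auto simp: indicator_def)
  qed auto
  show "integrable lborel (\<lambda>x. (norm (indicator (cball 0 R) x *\<^sub>R f x))\<^sup>2)"
    by (rule Bochner_Integration.integrable_bound[OF f2]) (auto simp: indicator_def)
qed

lemma integrable_truncated_fourier_integrand:
  fixes f :: "real^'d \<Rightarrow> complex^'n"
  assumes "square_integrable f"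
  shows "integrable lborel (\<lambda>x. indicator (cball 0 R) x *\<^sub>R (cis (- (\<xi> \<bullet> x)) *s f x))"
proof -
  have [measurable]: "f \<in> borel_measurable borel" using assms by (rule square_integrable_borel)
  show ?thesis
    by (rule Bochner_Integration.integrable_bound[OF square_integrable_indicator_cball(1)[OF assms, of R]])
      (auto simp: norm_vector_scalar_mult)
qed

lemma borel_measurable_truncated_fourier:
  fixes f :: "real^'d \<Rightarrow> complex^'n"
  assumes "square_integrable f"
  shows "truncated_fourier R f \<in> borel_measurable borel"
proof -
  have [measurable]: "f \<in> borel_measurable borel" using assms by (rule square_integrable_borel)
  have "(\<lambda>p. indicator (cball 0 R) (snd p) *\<^sub>R (cis (- (fst p \<bullet> snd p)) *s f (snd p)))
      \<in> borel_measurable ((borel :: (real^'d) measure) \<Otimes>\<^sub>M lborel)"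
  proof (intro borel_measurable_scaleR borel_measurable_vector_scalar_mult)
    show "(\<lambda>p. indicat_real (cball 0 R) (snd p)) \<in> borel_measurable ((borel :: (real^'d) measure) \<Otimes>\<^sub>M (lborel :: (real^'d) measure))"
      by (rule measurable_compose[OF measurable_snd]) (intro borel_measurable_indicator, simp)
    show "(\<lambda>p. f (snd p)) \<in> borel_measurable ((borel :: (real^'d) measure) \<Otimes>\<^sub>M lborel)"
      by (rule measurable_compose[OF measurable_snd]) simp
  qed measurable
  then have "(\<lambda>\<xi>. \<integral>x. indicator (cball 0 R) x *\<^sub>R (cis (- (\<xi> \<bullet> x)) *s f x) \<partial>lborel) \<in> borel_measurable borel"
    by (intro lborel.borel_measurable_lebesgue_integral) (simp add: case_prod_beta')
  then show ?thesis
    unfolding truncated_fourier_def[abs_def] set_lebesgue_integral_def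
    by (intro borel_measurable_scaleR borel_measurable_const)
qed

text \<open>\<open>bounded_linear\<close> means linear over the reals; moving \<open>T\<close> past
  the complex phase also takes homogeneity over complex scalars.\<close>

lemma truncated_fourier_linear:
  fixes f :: "real^'d \<Rightarrow> complex^'n" and T :: "complex^'n \<Rightarrow> complex^'m"
  assumes f: "square_integrable f" and T: "bounded_linear T" and Ts: "\<And>c v. T (c *s v) = c *s T v"
  shows "truncated_fourier R (\<lambda>x. T (f x)) \<xi> = T (truncated_fourier R f \<xi>)"
proof -
  note lin = bounded_linear.linear[OF T]
  show ?thesis
    unfolding truncated_fourier_def set_lebesgue_integral_def
    using integral_bounded_linear[OF T integrable_truncated_fourier_integrand[OF f, of R \<xi>]]
    by (simp add: Ts linear_scale[OF lin])
qed

lemma truncated_fourier_diff: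
  fixes f g :: "real^'d \<Rightarrow> complex^'n"
  assumes "square_integrable f" "square_integrable g"
  shows "truncated_fourier R (\<lambda>x. f x - g x) \<xi> = truncated_fourier R f \<xi> - truncated_fourier R g \<xi>"
proof -
  have "indicator (cball 0 R) x *\<^sub>R (cis (- (\<xi> \<bullet> x)) *s (f x - g x)) =
      indicator (cball 0 R) x *\<^sub>R (cis (- (\<xi> \<bullet> x)) *s f x) - indicator (cball 0 R) x *\<^sub>R (cis (- (\<xi> \<bullet> x)) *s g x)" for x
    by (simp add: bounded_bilinear.diff_right[OF bounded_bilinear_vector_scalar_mult] scaleR_diff_right)
  then show ?thesis
    unfolding truncated_fourier_def set_lebesgue_integral_def
    using integrable_truncated_fourier_integrand[OF assms(1), of R \<xi>]
      integrable_truncated_fourier_integrand[OF assms(2), of R \<xi>]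
    by (simp add: scaleR_diff_right)
qed

lemma truncated_fourier_nth:
  fixes f :: "real^'d \<Rightarrow> complex^'n"
  assumes f: "square_integrable f"
  shows "truncated_fourier R f \<xi> $ i =
    (2 * pi) powr (- real CARD('d) / 2) * L1_fourier (\<lambda>x. indicator (cball 0 R) x *\<^sub>R f x $ i) \<xi>"
proof -
  have "(\<integral>x. indicator (cball 0 R) x *\<^sub>R (cis (- (\<xi> \<bullet> x)) *s f x) \<partial>lborel) $ i =
      (\<integral>x. (indicator (cball 0 R) x *\<^sub>R (cis (- (\<xi> \<bullet> x)) *s f x)) $ i \<partial>lborel)"
    by (rule integral_bounded_linear[OF bounded_linear_vec_nth integrable_truncated_fourier_integrand[OF f], symmetric])
  also have "\<dots> = L1_fourier (\<lambda>x. indicator (cball 0 R) x *\<^sub>R f x $ i) \<xi>"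
    unfolding L1_fourier_def
    by (intro Bochner_Integration.integral_cong refl) (simp add: indicator_def)
  finally have eq: "(\<integral>x. indicator (cball 0 R) x *\<^sub>R (cis (- (\<xi> \<bullet> x)) *s f x) \<partial>lborel) $ i =
      L1_fourier (\<lambda>x. indicator (cball 0 R) x *\<^sub>R f x $ i) \<xi>" .
  show ?thesis
    unfolding truncated_fourier_def set_lebesgue_integral_def vector_scaleR_component eq
    by (rule scaleR_conv_of_real)
qed

text \<open>The scalar inequality is applied to each component of the cut-off function and summed;
  the square of the unitary factor cancels the power of \<open>2 * pi\<close>.\<close>

lemma plancherel_truncated_le:
  fixes f :: "real^'d \<Rightarrow> complex^'n"
  assumes f: "square_integrable f"
    and F: "integrable lborel (\<lambda>\<xi>. (norm (truncated_fourier R f \<xi>))\<^sup>2)"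
  shows "(\<integral>x. (norm (indicator (cball 0 R) x *\<^sub>R f x))\<^sup>2 \<partial>lborel)
    \<le> (\<integral>\<xi>. (norm (truncated_fourier R f \<xi>))\<^sup>2 \<partial>lborel)"
proof -
  have [measurable]: "f \<in> borel_measurable borel" using f by (rule square_integrable_borel)
  have [measurable]: "truncated_fourier R f \<in> borel_measurable borel"
    by (rule borel_measurable_truncated_fourier[OF f])
  define h where "h i x = (indicator (cball 0 R) x *\<^sub>R f x) $ i" for i x
  define T where "T i \<xi> = truncated_fourier R f \<xi> $ i" for i \<xi>
  have [measurable]: "h i \<in> borel_measurable borel" "T i \<in> borel_measurable borel" for i
    unfolding h_def T_def
    by (intro borel_measurable_vec_nth_comp borel_measurable_cball_cutoff; measurable)+
  define c where "c = (2 * pi) powr (- real CARD('d) / 2)"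
  have c: "c\<^sup>2 * (2 * pi) ^ CARD('d) = 1"
  proof -
    have "c\<^sup>2 = (2 * pi) powr (- real CARD('d))"
      by (simp add: c_def power2_eq_square flip: powr_add)
    also have "\<dots> = inverse ((2 * pi) ^ CARD('d))"
      by (subst powr_minus, subst powr_realpow) auto
    finally have "c\<^sup>2 = inverse ((2 * pi) ^ CARD('d))" .
    moreover have "(2 * pi) ^ CARD('d) \<noteq> 0" by simp
    ultimately show ?thesis by (metis left_inverse)
  qed
  have nv: "(norm v)\<^sup>2 = (\<Sum>i\<in>UNIV. (norm (v $ i))\<^sup>2)" for v :: "complex^'n"
    by (simp add: norm_vec_def L2_set_def sum_nonneg)
  have h1: "integrable lborel (h i)" for i
    unfolding h_def by (rule integrable_bounded_linear[OF bounded_linear_vec_nth square_integrable_indicator_cball(1)[OF f]])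
  have h2: "integrable lborel (\<lambda>x. (norm (h i x))\<^sup>2)" for i
  proof (rule Bochner_Integration.integrable_bound[OF square_integrable_indicator_cball(2)[OF f, of R]])
    show "AE x in lborel. norm ((norm (h i x))\<^sup>2) \<le> norm ((norm (indicator (cball 0 R) x *\<^sub>R f x))\<^sup>2)"
      unfolding h_def using Finite_Cartesian_Product.norm_nth_le by (intro AE_I2) (simp add: power_mono del: norm_scaleR vector_scaleR_component)
  qed auto
  have T2: "integrable lborel (\<lambda>\<xi>. (norm (T i \<xi>))\<^sup>2)" for i
  proof (rule Bochner_Integration.integrable_bound[OF F])
    show "AE \<xi> in lborel. norm ((norm (T i \<xi>))\<^sup>2) \<le> norm ((norm (truncated_fourier R f \<xi>))\<^sup>2)"
      unfolding T_def using Finite_Cartesian_Product.norm_nth_le by (intro AE_I2) (simp add: power_mono)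
  qed auto
  have Th: "norm (T i \<xi>) = c * norm (L1_fourier (h i) \<xi>)" for i \<xi>
    by (simp add: T_def h_def[abs_def] truncated_fourier_nth[OF f] c_def norm_mult)
  have "c > 0" by (simp add: c_def)
  have le: "(\<integral>x. (norm (h i x))\<^sup>2 \<partial>lborel) \<le> (\<integral>\<xi>. (norm (T i \<xi>))\<^sup>2 \<partial>lborel)" for i
  proof -
    have "integrable lborel (\<lambda>\<xi>. inverse (c\<^sup>2) * (norm (T i \<xi>))\<^sup>2)" using T2 by simp
    then have "integrable lborel (\<lambda>\<xi>. (norm (L1_fourier (h i) \<xi>))\<^sup>2)"
      using \<open>c > 0\<close> by (simp add: Th power_mult_distrib)
    from plancherel_L1_L2_le[OF h1 h2 this]
    have "c\<^sup>2 * ((2 * pi) ^ CARD('d) * (\<integral>x. (norm (h i x))\<^sup>2 \<partial>lborel)) \<le> c\<^sup>2 * (\<integral>\<xi>. (norm (L1_fourier (h i) \<xi>))\<^sup>2 \<partial>lborel)"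
      by (intro mult_left_mono) auto
    then have "(c\<^sup>2 * (2 * pi) ^ CARD('d)) * (\<integral>x. (norm (h i x))\<^sup>2 \<partial>lborel) \<le> c\<^sup>2 * (\<integral>\<xi>. (norm (L1_fourier (h i) \<xi>))\<^sup>2 \<partial>lborel)"
      by (simp only: mult.assoc)
    then show ?thesis
      unfolding c by (simp add: Th power_mult_distrib)
  qed
  have "(\<integral>x. (norm (indicator (cball 0 R) x *\<^sub>R f x))\<^sup>2 \<partial>lborel) = (\<Sum>i\<in>UNIV. \<integral>x. (norm (h i x))\<^sup>2 \<partial>lborel)"
    unfolding nv by (subst Bochner_Integration.integral_sum[symmetric]) (use h2 in \<open>simp_all only: h_def[abs_def]\<close>)
  also have "\<dots> \<le> (\<Sum>i\<in>UNIV. \<integral>\<xi>. (norm (T i \<xi>))\<^sup>2 \<partial>lborel)" by (intro sum_mono le)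
  also have "\<dots> = (\<integral>\<xi>. (norm (truncated_fourier R f \<xi>))\<^sup>2 \<partial>lborel)"
    unfolding nv by (subst Bochner_Integration.integral_sum[symmetric]) (use T2 in \<open>simp_all only: T_def[abs_def]\<close>)
  finally show ?thesis .
qed

section \<open>Linearity, uniqueness and norm inequality for the \<open>L^2\<close> Fourier
  relation\<close>

lemma has_L2_fourier_diff:
  fixes f f' :: "real^'d \<Rightarrow> complex^'n"
  assumes "has_L2_fourier f g" "has_L2_fourier f' g'"
  shows "has_L2_fourier (\<lambda>x. f x - f' x) (\<lambda>\<xi>. g \<xi> - g' \<xi>)"
proof -
  have sq: "square_integrable f" "square_integrable g" "square_integrable f'" "square_integrable g'"
    using assms by (auto simp: has_L2_fourier_def)
  note [measurable] = square_integrable_borel[OF sq(2)] square_integrable_borel[OF sq(4)]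
    borel_measurable_truncated_fourier[OF sq(1)] borel_measurable_truncated_fourier[OF sq(3)]
  define e where "e R = (\<integral>\<^sup>+ \<xi>. ennreal ((norm (truncated_fourier R f \<xi> - g \<xi>))\<^sup>2) \<partial>lborel)" for R
  define e' where "e' R = (\<integral>\<^sup>+ \<xi>. ennreal ((norm (truncated_fourier R f' \<xi> - g' \<xi>))\<^sup>2) \<partial>lborel)" for R
  have "((\<lambda>R. 2 * e R + 2 * e' R) \<longlongrightarrow> 2 * 0 + 2 * 0) at_top"
    using assms unfolding has_L2_fourier_def e_def e'_def
    by (intro tendsto_add ennreal_tendsto_cmult) auto
  then have lim: "((\<lambda>R. 2 * e R + 2 * e' R) \<longlongrightarrow> 0) at_top" by simp
  have "((\<lambda>R. \<integral>\<^sup>+ \<xi>. ennreal ((norm (truncated_fourier R (\<lambda>x. f x - f' x) \<xi> - (g \<xi> - g' \<xi>)))\<^sup>2) \<partial>lborel) \<longlongrightarrow> 0) at_top"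
  proof (rule tendsto_sandwich[OF _ _ tendsto_const lim])
    show "\<forall>\<^sub>F R in at_top. (\<integral>\<^sup>+ \<xi>. ennreal ((norm (truncated_fourier R (\<lambda>x. f x - f' x) \<xi> - (g \<xi> - g' \<xi>)))\<^sup>2) \<partial>lborel)
        \<le> 2 * e R + 2 * e' R"
    proof (intro always_eventually allI)
      fix R
      have pt: "ennreal ((norm (truncated_fourier R (\<lambda>x. f x - f' x) \<xi> - (g \<xi> - g' \<xi>)))\<^sup>2) \<le>
          2 * ennreal ((norm (truncated_fourier R f \<xi> - g \<xi>))\<^sup>2) + 2 * ennreal ((norm (truncated_fourier R f' \<xi> - g' \<xi>))\<^sup>2)" for \<xi>
      proof -
        have "truncated_fourier R (\<lambda>x. f x - f' x) \<xi> - (g \<xi> - g' \<xi>) =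
            (truncated_fourier R f \<xi> - g \<xi>) + (- (truncated_fourier R f' \<xi> - g' \<xi>))"
          by (simp add: truncated_fourier_diff[OF sq(1,3)])
        then have "(norm (truncated_fourier R (\<lambda>x. f x - f' x) \<xi> - (g \<xi> - g' \<xi>)))\<^sup>2 \<le>
            2 * (norm (truncated_fourier R f \<xi> - g \<xi>))\<^sup>2 + 2 * (norm (truncated_fourier R f' \<xi> - g' \<xi>))\<^sup>2"
          using norm_add_square_le[of "truncated_fourier R f \<xi> - g \<xi>" "- (truncated_fourier R f' \<xi> - g' \<xi>)"]
          by (simp only: norm_minus_cancel)
        then have "ennreal ((norm (truncated_fourier R (\<lambda>x. f x - f' x) \<xi> - (g \<xi> - g' \<xi>)))\<^sup>2) \<le>
            ennreal (2 * (norm (truncated_fourier R f \<xi> - g \<xi>))\<^sup>2 + 2 * (norm (truncated_fourier R f' \<xi> - g' \<xi>))\<^sup>2)"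
          by (rule ennreal_leI)
        then show ?thesis by (simp add: ennreal_mult)
      qed
      show "(\<integral>\<^sup>+ \<xi>. ennreal ((norm (truncated_fourier R (\<lambda>x. f x - f' x) \<xi> - (g \<xi> - g' \<xi>)))\<^sup>2) \<partial>lborel)
        \<le> 2 * e R + 2 * e' R"
      proof -
        have "(\<integral>\<^sup>+ \<xi>. ennreal ((norm (truncated_fourier R (\<lambda>x. f x - f' x) \<xi> - (g \<xi> - g' \<xi>)))\<^sup>2) \<partial>lborel) \<le>
          (\<integral>\<^sup>+ \<xi>. 2 * ennreal ((norm (truncated_fourier R f \<xi> - g \<xi>))\<^sup>2) +
            2 * ennreal ((norm (truncated_fourier R f' \<xi> - g' \<xi>))\<^sup>2) \<partial>lborel)"
          by (intro nn_integral_mono pt)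
        also have "\<dots> = 2 * e R + 2 * e' R"
          unfolding e_def e'_def by (subst nn_integral_add; simp add: nn_integral_cmult)
        finally show ?thesis .
      qed
    qed
  qed simp
  then show ?thesis
    using sq by (simp add: has_L2_fourier_def square_integrable_diff)
qed

text \<open>Meant for \<open>T = slow\<close>, a contraction that commutes with complex scalars:
  applying it cannot enlarge the error of the truncated transforms.\<close>

lemma has_L2_fourier_linear:
  fixes f :: "real^'d \<Rightarrow> complex^'n" and T :: "complex^'n \<Rightarrow> complex^'m"
  assumes f: "has_L2_fourier f g" and T: "bounded_linear T" and Ts: "\<And>c v. T (c *s v) = c *s T v"
    and T1: "\<And>v. norm (T v) \<le> norm v"
  shows "has_L2_fourier (\<lambda>x. T (f x)) (\<lambda>\<xi>. T (g \<xi>))"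
proof -
  have sq: "square_integrable f" "square_integrable g"
    using f by (auto simp: has_L2_fourier_def)
  have sqT: "square_integrable (\<lambda>x. T (h x))" if "square_integrable h" for h :: "real^'d \<Rightarrow> complex^'n"
  proof -
    have [measurable]: "h \<in> borel_measurable borel" using that by (rule square_integrable_borel)
    have [measurable]: "(\<lambda>x. T (h x)) \<in> borel_measurable borel"
      by (rule borel_measurable_continuous_on[of T]) (auto intro: linear_continuous_on T)
    have "integrable lborel (\<lambda>x. (norm (h x))\<^sup>2)" using that by (simp add: square_integrable_def)
    then have "integrable lborel (\<lambda>x. (norm (T (h x)))\<^sup>2)"
      by (rule Bochner_Integration.integrable_bound) (auto intro!: AE_I2 power_mono T1)
    then show ?thesis by (simp add: square_integrable_def)
  qed
  have "((\<lambda>R. \<integral>\<^sup>+ \<xi>. ennreal ((norm (truncated_fourier R (\<lambda>x. T (f x)) \<xi> - T (g \<xi>)))\<^sup>2) \<partial>lborel) \<longlongrightarrow> 0) at_top"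
  proof (rule tendsto_sandwich[OF _ _ tendsto_const])
    show "((\<lambda>R. \<integral>\<^sup>+ \<xi>. ennreal ((norm (truncated_fourier R f \<xi> - g \<xi>))\<^sup>2) \<partial>lborel) \<longlongrightarrow> 0) at_top"
      using f by (simp add: has_L2_fourier_def)
    show "\<forall>\<^sub>F R in at_top. (\<integral>\<^sup>+ \<xi>. ennreal ((norm (truncated_fourier R (\<lambda>x. T (f x)) \<xi> - T (g \<xi>)))\<^sup>2) \<partial>lborel)
      \<le> (\<integral>\<^sup>+ \<xi>. ennreal ((norm (truncated_fourier R f \<xi> - g \<xi>))\<^sup>2) \<partial>lborel)"
    proof (intro always_eventually allI nn_integral_mono ennreal_leI power_mono)
      fix R \<xi>
      have "truncated_fourier R (\<lambda>x. T (f x)) \<xi> - T (g \<xi>) = T (truncated_fourier R f \<xi> - g \<xi>)"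
        by (simp add: truncated_fourier_linear[OF sq(1) T Ts] linear_diff[OF bounded_linear.linear[OF T]])
      then show "norm (truncated_fourier R (\<lambda>x. T (f x)) \<xi> - T (g \<xi>)) \<le> norm (truncated_fourier R f \<xi> - g \<xi>)"
        by (simp add: T1)
    qed simp
  qed simp
  then show ?thesis using sq sqT by (simp add: has_L2_fourier_def)
qed

text \<open>The difference \<open>g - g'\<close> is a transform of the zero function, whose
  truncated transforms all vanish. The error in the defining limit is then constant in the radius,
  hence zero.\<close>

lemma has_L2_fourier_unique:
  fixes f :: "real^'d \<Rightarrow> complex^'n"
  assumes "has_L2_fourier f g" "has_L2_fourier f g'"
  shows "AE \<xi> in lborel. g \<xi> = g' \<xi>"
proof -
  have z: "has_L2_fourier (\<lambda>x. 0) (\<lambda>\<xi>. g \<xi> - g' \<xi>)"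
    using has_L2_fourier_diff[OF assms] by simp
  have [measurable]: "g \<in> borel_measurable borel" "g' \<in> borel_measurable borel"
    using assms by (auto simp: has_L2_fourier_def square_integrable_def)
  have "truncated_fourier R (\<lambda>x. 0) \<xi> = (0 :: complex^'n)" for R and \<xi> :: "real^'d"
    by (simp add: truncated_fourier_def set_lebesgue_integral_def)
  then have "(\<integral>\<^sup>+ \<xi>. ennreal ((norm (g \<xi> - g' \<xi>))\<^sup>2) \<partial>lborel) = 0"
    using z unfolding has_L2_fourier_def by (simp add: norm_minus_commute[of "g' _"] tendsto_const_iff)
  then have "AE \<xi> in lborel. ennreal ((norm (g \<xi> - g' \<xi>))\<^sup>2) = 0"
    by (subst (asm) nn_integral_0_iff_AE) auto
  then show ?thesis by eventually_elim (simp add: ennreal_eq_0_iff)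
qed

text \<open>A fixed ball is contained in all large ones, whose truncated transforms approach
  \<open>g\<close>. Three limits follow one another: the approximation error tends to
  \<open>0\<close>, then the weight \<open>s\<close> tends to \<open>0\<close>, and finally the ball
  exhausts the space.\<close>

lemma L2norm_le_fourier:
  assumes fg: "has_L2_fourier f g"
  shows "L2norm f \<le> L2norm g"
proof -
  have sq: "square_integrable f" "square_integrable g"
    using fg by (auto simp: has_L2_fourier_def)
  note [measurable] = square_integrable_borel[OF sq(1)] square_integrable_borel[OF sq(2)]
    borel_measurable_truncated_fourier[OF sq(1)]
  define A where "A R = (\<integral>x. (norm (indicator (cball 0 R) x *\<^sub>R f x))\<^sup>2 \<partial>lborel)" for R
  define B where "B = (\<integral>\<xi>. (norm (g \<xi>))\<^sup>2 \<partial>lborel)"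
  have B: "integrable lborel (\<lambda>\<xi>. (norm (g \<xi>))\<^sup>2)" "B \<ge> 0"
    using sq by (auto simp: square_integrable_def B_def)
  \<comment> \<open>The weight \<open>s\<close> separates the limit from the error: \<open>g\<close>
    is charged \<open>1 + s\<close> and the error \<open>1 + 1 / s\<close>, which does no harm as
    the error vanishes for fixed \<open>s\<close>.\<close>
  have step: "A R0 \<le> (1 + s) * B" if s: "s > 0" for R0 s
  proof (rule field_le_epsilon)
    fix e :: real assume "e > 0"
    define e' where "e' = e / (1 + 1 / s)"
    have e': "e' > 0" "(1 + 1 / s) * e' = e"
      using \<open>e > 0\<close> s add_pos_pos[of 1 "1 / s"] by (auto simp: e'_def)
    have "((\<lambda>R. \<integral>\<^sup>+ \<xi>. ennreal ((norm (truncated_fourier R f \<xi> - g \<xi>))\<^sup>2) \<partial>lborel) \<longlongrightarrow> 0) at_top"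
      using fg by (simp add: has_L2_fourier_def)
    then have "\<forall>\<^sub>F R in at_top. (\<integral>\<^sup>+ \<xi>. ennreal ((norm (truncated_fourier R f \<xi> - g \<xi>))\<^sup>2) \<partial>lborel) < ennreal e'"
      by (rule order_tendstoD) (use e' in simp)
    then have "\<forall>\<^sub>F R in at_top. R0 \<le> R \<and> (\<integral>\<^sup>+ \<xi>. ennreal ((norm (truncated_fourier R f \<xi> - g \<xi>))\<^sup>2) \<partial>lborel) < ennreal e'"
      using eventually_ge_at_top[of R0] by eventually_elim simp
    then obtain R where R: "R0 \<le> R"
      and lt: "(\<integral>\<^sup>+ \<xi>. ennreal ((norm (truncated_fourier R f \<xi> - g \<xi>))\<^sup>2) \<partial>lborel) < ennreal e'"
      using eventually_happens'[OF trivial_limit_at_top_linorder] by blast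
    define E where "E \<xi> = (norm (truncated_fourier R f \<xi> - g \<xi>))\<^sup>2" for \<xi>
    \<comment> \<open>Finiteness of this error is what makes the truncated transform
      square-integrable, a premise of \<open>plancherel_truncated_le\<close>.\<close>
    have E: "integrable lborel E"
      unfolding E_def using lt by (intro integrableI_nonneg) (auto intro: order.strict_trans)
    have "(\<integral>\<^sup>+ \<xi>. ennreal (E \<xi>) \<partial>lborel) = ennreal (\<integral>\<xi>. E \<xi> \<partial>lborel)"
      by (rule nn_integral_eq_integral[OF E]) (simp add: E_def)
    then have "ennreal (\<integral>\<xi>. E \<xi> \<partial>lborel) < ennreal e'"
      using lt unfolding E_def by simp
    then have Ee: "(\<integral>\<xi>. E \<xi> \<partial>lborel) < e'" using e' by (simp add: ennreal_less_iff E_def integral_nonneg_AE)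
    have pt: "(norm (truncated_fourier R f \<xi>))\<^sup>2 \<le> (1 + s) * (norm (g \<xi>))\<^sup>2 + (1 + 1 / s) * E \<xi>" for \<xi>
    proof -
      let ?a = "norm (g \<xi>)" and ?b = "norm (truncated_fourier R f \<xi> - g \<xi>)"
      have "(norm (truncated_fourier R f \<xi>))\<^sup>2 \<le> (?a + ?b)\<^sup>2"
        using norm_triangle_ineq[of "g \<xi>" "truncated_fourier R f \<xi> - g \<xi>"] by (intro power_mono) auto
      also have "\<dots> \<le> (?a + ?b)\<^sup>2 + (s * ?a - ?b)\<^sup>2 / s" using s by simp
      also have "\<dots> = (1 + s) * ?a\<^sup>2 + (1 + 1 / s) * ?b\<^sup>2"
        using s by (simp add: power2_eq_square field_simps)
      finally show ?thesis by (simp add: E_def)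
    qed
    have T: "integrable lborel (\<lambda>\<xi>. (norm (truncated_fourier R f \<xi>))\<^sup>2)"
    proof (rule Bochner_Integration.integrable_bound)
      show "integrable lborel (\<lambda>\<xi>. (1 + s) * (norm (g \<xi>))\<^sup>2 + (1 + 1 / s) * E \<xi>)" using B E by auto
      show "AE \<xi> in lborel. norm ((norm (truncated_fourier R f \<xi>))\<^sup>2) \<le> norm ((1 + s) * (norm (g \<xi>))\<^sup>2 + (1 + 1 / s) * E \<xi>)"
        using pt by (intro AE_I2) (simp add: order_trans[OF _ abs_ge_self])
    qed auto
    have "A R0 \<le> A R"
      unfolding A_def using R
      by (intro integral_mono square_integrable_indicator_cball(2)[OF sq(1)]) (auto simp: indicator_def)
    also have "\<dots> \<le> (\<integral>\<xi>. (norm (truncated_fourier R f \<xi>))\<^sup>2 \<partial>lborel)"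
      unfolding A_def by (rule plancherel_truncated_le[OF sq(1) T])
    also have "\<dots> \<le> (\<integral>\<xi>. (1 + s) * (norm (g \<xi>))\<^sup>2 + (1 + 1 / s) * E \<xi> \<partial>lborel)"
      using B E T by (intro integral_mono pt) auto
    also have "\<dots> = (1 + s) * B + (1 + 1 / s) * (\<integral>\<xi>. E \<xi> \<partial>lborel)"
      using B E by (simp add: B_def)
    also have "\<dots> \<le> (1 + s) * B + (1 + 1 / s) * e'"
      using Ee s by (intro add_left_mono mult_left_mono) auto
    finally show "A R0 \<le> (1 + s) * B + e" by (simp add: e')
  qed
  have AB: "A R \<le> B" for R
  proof (rule field_le_epsilon)
    fix e :: real assume "e > 0"
    \<comment> \<open>With this weight the excess \<open>s * B\<close> is at most \<open>e\<close>,
      also when \<open>B = 0\<close>.\<close>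
    then have "A R \<le> (1 + e / (B + 1)) * B" using B by (intro step) (simp add: add_nonneg_pos)
    also have "\<dots> \<le> B + e" using B \<open>e > 0\<close> by (simp add: field_simps)
    finally show "A R \<le> B + e" .
  qed
  have "(\<lambda>n. A (real n)) \<longlonglongrightarrow> (\<integral>x. (norm (f x))\<^sup>2 \<partial>lborel)"
    unfolding A_def
  proof (rule integral_dominated_convergence)
    show "integrable lborel (\<lambda>x. (norm (f x))\<^sup>2)" using sq by (simp add: square_integrable_def)
    show "AE x in lborel. (\<lambda>n. (norm (indicator (cball 0 (real n)) x *\<^sub>R f x))\<^sup>2) \<longlonglongrightarrow> (norm (f x))\<^sup>2"
    proof (rule AE_I2)
      fix x
      have "\<forall>\<^sub>F n in sequentially. (norm (indicator (cball 0 (real n)) x *\<^sub>R f x))\<^sup>2 = (norm (f x))\<^sup>2"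
        using eventually_ge_at_top[of "nat \<lceil>norm x\<rceil>"]
        by eventually_elim (auto simp: nat_le_iff ceiling_le_iff)
      then show "(\<lambda>n. (norm (indicator (cball 0 (real n)) x *\<^sub>R f x))\<^sup>2) \<longlonglongrightarrow> (norm (f x))\<^sup>2"
        by (rule tendsto_eventually)
    qed
  qed (auto simp: indicator_def)
  then have "(\<integral>x. (norm (f x))\<^sup>2 \<partial>lborel) \<le> B"
    by (rule LIMSEQ_le_const2) (use AB in auto)
  then show ?thesis by (simp add: L2norm_def B_def)
qed

section \<open>The relaxation limit\<close>

lemma continuous_on_matpow:
  fixes P :: "'a::topological_space \<Rightarrow> complex^'n^'n"
  assumes "continuous_on S P"
  shows "continuous_on S (\<lambda>x. matpow (P x) k)"
proof (induction k)
  case (Suc k)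
  have "continuous_on S (\<lambda>x. \<chi> i j. \<Sum>l\<in>UNIV. P x $ i $ l * matpow (P x) k $ l $ j)"
    by (intro continuous_on_vec_lambda continuous_on_sum continuous_on_mult continuous_on_component assms Suc)
  then show ?case by (simp add: matpow_def matrix_matrix_mult_def)
qed (simp add: matpow_def)

text \<open>The matrix powers depend continuously on the parameter, so the exponential is measurable
  as the sum of a series of measurable functions.\<close>

lemma borel_measurable_matexp_vec:
  fixes P :: "'a::topological_space \<Rightarrow> complex^'n^'n"
  assumes P: "continuous_on UNIV P" and g: "g \<in> borel_measurable borel"
  shows "(\<lambda>x. matexp (P x) *v g x) \<in> borel_measurable borel"
proof (rule borel_measurable_continuous_Pair[where H="(*v)" and f="\<lambda>x. matexp (P x)", OF _ g])
  show "(\<lambda>x. matexp (P x)) \<in> borel_measurable borel"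
    unfolding matexp_def
    by (intro borel_measurable_suminf borel_measurable_scaleR borel_measurable_const
        borel_measurable_continuous_onI continuous_on_matpow P)
  show "continuous_on UNIV (\<lambda>x :: (complex^'n^'n) \<times> (complex^'n). fst x *v snd x)"
    by (intro bounded_bilinear.continuous_on[OF bounded_bilinear_matrix_vector_mult] continuous_intros)
qed

lemma continuous_on_flux_symbol: "continuous_on S (flux_symbol A)"
  by (rule linear_continuous_on) (simp add: linear_conv_bounded_linear[symmetric] linear_flux_symbol)

lemma continuous_on_H: "continuous_on S (\<lambda>\<xi>. H A Q \<xi> \<eta>)"
  unfolding H_conv_flux by (intro continuous_intros continuous_on_flux_symbol)

section \<open>Stability of the reduced propagator\<close>

lemma uniformly_quasi_stable_bound:
  assumes "uniformly_quasi_stable F"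
  obtains K where "K \<ge> 1" "\<And>M t. M \<in> F \<Longrightarrow> t \<ge> 0 \<Longrightarrow> onorm ((*v) (matexp (t *\<^sub>R M))) \<le> K"
proof -
  obtain B where "\<And>x. x \<in> {onorm ((*v) (matexp (t *\<^sub>R M))) | M t. M \<in> F \<and> t \<ge> 0} \<Longrightarrow> x \<le> B"
    using assms unfolding uniformly_quasi_stable_def bdd_above_def by blast
  then show thesis by (intro that[of "max 1 B"]) (auto simp: le_max_iff_disj)
qed

text \<open>At fixed time and frequency, the reduced orbit of \<open>v\<close> is the limit of the
  slow parts of full orbits that start at \<open>v\<close> with zero fast components. Each of these
  is bounded by \<open>K * norm v\<close>, so the limit inherits the same \<open>K\<close>.\<close>

lemma onorm_reduced_le:
  fixes A :: "'d::finite \<Rightarrow> real^('m::finite + 'r::finite)^('m + 'r)"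
  assumes Q: "relaxation_block_form Q" and K1: "K \<ge> 1"
    and K: "\<And>\<xi> \<eta> t. \<eta> \<ge> 0 \<Longrightarrow> t \<ge> 0 \<Longrightarrow> onorm ((*v) (matexp (t *\<^sub>R H A Q \<xi> \<eta>))) \<le> K"
    and t: "t \<ge> 0"
  shows "onorm ((*v) (matexp (t *\<^sub>R flux_symbol (\<lambda>j. block11 (A j)) \<xi>))) \<le> K"
proof (rule onorm_le)
  fix v :: "complex^'m"
  define M where "M = flux_symbol (\<lambda>j. block11 (A j)) \<xi>"
  define w :: "complex^('m + 'r)" where "w = embed_slow v"
  obtain c where c: "c \<ge> 0" "\<And>\<xi> \<epsilon> t K w. \<lbrakk>\<epsilon> > 0; t \<ge> 0; K \<ge> 1;
       \<And>s. s \<in> {0..t} \<Longrightarrow> norm (matexp (s *\<^sub>R H A Q \<xi> (1 / \<epsilon>)) *v w) \<le> K * norm w;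
       \<And>s. s \<in> {0..t} \<Longrightarrow> onorm ((*v) (matexp (s *\<^sub>R flux_symbol (\<lambda>j. block11 (A j)) \<xi>))) \<le> K\<rbrakk> \<Longrightarrow>
     norm (slow (matexp (t *\<^sub>R H A Q \<xi> (1 / \<epsilon>)) *v w) -
        matexp (t *\<^sub>R flux_symbol (\<lambda>j. block11 (A j)) \<xi>) *v slow w)
     \<le> c * \<epsilon> * K\<^sup>2 * (1 + t) * (1 + (norm \<xi>)\<^sup>2) * norm w"
    by (rule slow_matexp_relaxation_estimate[OF Q, of A]) blast
  obtain K' where K': "\<forall>s\<in>{0..t}. onorm ((*v) (matexp (s *\<^sub>R M))) \<le> K'"
    using onorm_matexp_locally_bounded by blast
  \<comment> \<open>\<open>K2\<close> and hence \<open>D\<close> may depend on time, frequency and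
    the crude bound \<open>K'\<close>; this is harmless since \<open>D\<close> is multiplied by
    \<open>\<epsilon>\<close>.\<close>
  define K2 where "K2 = max K K'"
  define D where "D = c * K2\<^sup>2 * (1 + t) * (1 + (norm \<xi>)\<^sup>2) * norm w"
  have "D \<ge> 0" using c t by (simp add: D_def)
  have HK: "norm (matexp (s *\<^sub>R H A Q \<xi> (1 / \<epsilon>)) *v w) \<le> K * norm w" if "s \<ge> 0" "\<epsilon> > 0" for s \<epsilon>
    using norm_matrix_vector_onorm[of "matexp (s *\<^sub>R H A Q \<xi> (1 / \<epsilon>))" w] K[of "1 / \<epsilon>" s \<xi>] that
    by (meson divide_nonneg_nonneg less_imp_le mult_right_mono norm_ge_zero order_trans zero_le_one)
  have le: "norm (matexp (t *\<^sub>R M) *v v) \<le> K * norm v + D * \<epsilon>" if \<epsilon>: "\<epsilon> > 0" for \<epsilon>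
  proof -
    let ?y = "matexp (t *\<^sub>R H A Q \<xi> (1 / \<epsilon>)) *v w"
    have "norm (slow ?y - matexp (t *\<^sub>R M) *v slow w) \<le> c * \<epsilon> * K2\<^sup>2 * (1 + t) * (1 + (norm \<xi>)\<^sup>2) * norm w"
      unfolding M_def
    proof (rule c(2))
      fix s assume s: "s \<in> {0..t}"
      show "norm (matexp (s *\<^sub>R H A Q \<xi> (1 / \<epsilon>)) *v w) \<le> K2 * norm w"
        using HK[of s \<epsilon>] s \<epsilon> mult_right_mono[of K K2 "norm w"] by (auto simp: K2_def)
      show "onorm ((*v) (matexp (s *\<^sub>R flux_symbol (\<lambda>j. block11 (A j)) \<xi>))) \<le> K2"
        using bspec[OF K' s] by (simp add: K2_def M_def)
    qed (use \<epsilon> t K1 in \<open>auto simp: K2_def\<close>)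
    also have "\<dots> = D * \<epsilon>" by (simp add: D_def)
    finally have "norm (slow ?y - matexp (t *\<^sub>R M) *v v) \<le> D * \<epsilon>" by (simp add: w_def)
    moreover have "norm (slow ?y) \<le> K * norm v"
      using order_trans[OF norm_slow_le HK[OF t \<epsilon>]] by (simp add: w_def)
    ultimately show ?thesis
      using norm_triangle_ineq2[of "matexp (t *\<^sub>R M) *v v" "slow ?y"] by (simp add: norm_minus_commute)
  qed
  show "norm (matexp (t *\<^sub>R M) *v v) \<le> K * norm v"
  proof (rule field_le_epsilon)
    fix e :: real assume "e > 0"
    then have "norm (matexp (t *\<^sub>R M) *v v) \<le> K * norm v + D * (e / (D + 1))"
      using \<open>D \<ge> 0\<close> by (intro le) (simp add: add_nonneg_pos)
    also have "D * (e / (D + 1)) \<le> e"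
      using \<open>D \<ge> 0\<close> \<open>e > 0\<close> by (simp add: field_simps)
    finally show "norm (matexp (t *\<^sub>R M) *v v) \<le> K * norm v + e" by simp
  qed
qed

section \<open>The error in physical space and in frequency\<close>

lemma borel_measurable_slow_defect:
  fixes A :: "'d::finite \<Rightarrow> real^('m::finite + 'r::finite)^('m + 'r)"
  assumes g: "g \<in> borel_measurable borel"
  shows "(\<lambda>\<xi>. slow (matexp (t *\<^sub>R H A Q \<xi> \<eta>) *v g \<xi>) -
       matexp (t *\<^sub>R flux_symbol (\<lambda>j. block11 (A j)) \<xi>) *v slow (g \<xi>)) \<in> borel_measurable borel"
proof -
  have slow_borel [measurable]: "slow \<in> borel_measurable (borel :: (complex^('m + 'r)) measure)"
    by (intro borel_measurable_continuous_onI linear_continuous_on bounded_linear_slow)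
  show ?thesis
    by (intro borel_measurable_diff measurable_compose[OF _ slow_borel] borel_measurable_matexp_vec
        continuous_intros continuous_on_H continuous_on_flux_symbol g)
qed

text \<open>Each solution comes with its own representative of the transformed data. Uniqueness up
  to null sets replaces all of them by the prescribed \<open>g\<close>, so that one explicit symbol
  expresses the error.\<close>

lemma L2norm_slow_diff_le:
  fixes A :: "'d::finite \<Rightarrow> real^('m::finite + 'r::finite)^('m + 'r)"
    and U0 :: "real^'d \<Rightarrow> complex^('m + 'r)"
  assumes g: "has_L2_fourier U0 g"
    and U: "fourier_solution (\<lambda>\<xi>. H A Q \<xi> \<eta>) U0 U"
    and w: "fourier_solution (flux_symbol (\<lambda>j. block11 (A j))) (\<lambda>x. slow (U0 x)) w"
    and t: "t \<ge> 0"
  shows "L2norm (\<lambda>x. slow (U t x) - w t x) \<le>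
    L2norm (\<lambda>\<xi>. slow (matexp (t *\<^sub>R H A Q \<xi> \<eta>) *v g \<xi>) -
       matexp (t *\<^sub>R flux_symbol (\<lambda>j. block11 (A j)) \<xi>) *v slow (g \<xi>))"
proof -
  have slow_smult: "slow (c *s v) = c *s slow v" for c :: complex and v :: "complex^('m + 'r)"
    by (simp add: slow_def vec_eq_iff)
  note fourier_slow = has_L2_fourier_linear[where T=slow, OF _ bounded_linear_slow slow_smult norm_slow_le]
  obtain g1 where g1: "has_L2_fourier U0 g1" "has_L2_fourier (U t) (\<lambda>\<xi>. matexp (t *\<^sub>R H A Q \<xi> \<eta>) *v g1 \<xi>)"
    using U t by (auto simp: fourier_solution_def)
  obtain g2 where g2: "has_L2_fourier (\<lambda>x. slow (U0 x)) g2"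
    "has_L2_fourier (w t) (\<lambda>\<xi>. matexp (t *\<^sub>R flux_symbol (\<lambda>j. block11 (A j)) \<xi>) *v g2 \<xi>)"
    using w t by (auto simp: fourier_solution_def)
  have g_borel: "g \<in> borel_measurable borel" using g by (simp add: has_L2_fourier_def square_integrable_def)
  define D where "D \<xi> = slow (matexp (t *\<^sub>R H A Q \<xi> \<eta>) *v g \<xi>) -
       matexp (t *\<^sub>R flux_symbol (\<lambda>j. block11 (A j)) \<xi>) *v slow (g \<xi>)" for \<xi>
  define D' where "D' \<xi> = slow (matexp (t *\<^sub>R H A Q \<xi> \<eta>) *v g1 \<xi>) -
       matexp (t *\<^sub>R flux_symbol (\<lambda>j. block11 (A j)) \<xi>) *v g2 \<xi>" for \<xi>
  have f: "has_L2_fourier (\<lambda>x. slow (U t x) - w t x) D'"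
    unfolding D'_def by (intro has_L2_fourier_diff fourier_slow g1 g2)
  then have [measurable]: "D' \<in> borel_measurable borel" by (simp add: has_L2_fourier_def square_integrable_def)
  have [measurable]: "D \<in> borel_measurable borel"
    using borel_measurable_slow_defect[OF g_borel] by (simp add: D_def[abs_def])
  have "AE \<xi> in lborel. g1 \<xi> = g \<xi>" by (rule has_L2_fourier_unique[OF g1(1) g])
  moreover have "AE \<xi> in lborel. g2 \<xi> = slow (g \<xi>)"
    by (rule has_L2_fourier_unique[OF g2(1) fourier_slow[OF g]])
  ultimately have "AE \<xi> in lborel. D' \<xi> = D \<xi>" by eventually_elim (simp add: D_def D'_def)
  then have "(\<integral>\<xi>. (norm (D' \<xi>))\<^sup>2 \<partial>lborel) = (\<integral>\<xi>. (norm (D \<xi>))\<^sup>2 \<partial>lborel)"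
    by (intro integral_cong_AE) auto
  then have "L2norm D' = L2norm D" by (simp add: L2norm_def)
  then show ?thesis using L2norm_le_fourier[OF f] by (simp add: D_def[abs_def])
qed

theorem theorem3:
  fixes A :: "'d::finite \<Rightarrow> real^('m::finite + 'r::finite)^('m + 'r)"
    and Q :: "real^('m + 'r)^('m + 'r)"
  assumes "relaxation_block_form Q"
    and "stiffly_well_posed A Q"
  shows "strongly_hyperbolic (\<lambda>j. block11 (A j)) \<and>
    (\<forall>(U0 :: real^'d \<Rightarrow> complex^('m + 'r)) (U :: real \<Rightarrow> real^'d \<Rightarrow> real \<Rightarrow> complex^('m + 'r)) w.
       square_integrable U0 \<longrightarrow>
       (\<forall>\<epsilon>>0. fourier_solution (\<lambda>\<xi>. H A Q \<xi> (1 / \<epsilon>)) U0 (\<lambda>t x. U t x (1 / \<epsilon>))) \<longrightarrow>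
       fourier_solution (flux_symbol (\<lambda>j. block11 (A j))) (\<lambda>x. slow (U0 x)) w \<longrightarrow>
       (\<forall>t>0. ((\<lambda>\<epsilon>. L2norm (\<lambda>x. slow (U t x (1 / \<epsilon>)) - w t x)) \<longlongrightarrow> 0) (at_right 0))) \<and>
    (uniformly_quasi_stable {block22 (H A Q \<xi> \<eta>) | \<xi> \<eta>. \<eta> \<ge> 0} \<longrightarrow>
      (\<exists>C. \<exists>\<epsilon>0>0.
         \<forall>(U0 :: real^'d \<Rightarrow> complex^('m + 'r)) (U :: real \<Rightarrow> real^'d \<Rightarrow> real \<Rightarrow> complex^('m + 'r)) w.
           U0 \<in> sobolev_space 2 \<longrightarrow>
           (\<forall>\<epsilon>>0. fourier_solution (\<lambda>\<xi>. H A Q \<xi> (1 / \<epsilon>)) U0 (\<lambda>t x. U t x (1 / \<epsilon>))) \<longrightarrow>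
           fourier_solution (flux_symbol (\<lambda>j. block11 (A j))) (\<lambda>x. slow (U0 x)) w \<longrightarrow>
           (\<forall>t>0. \<forall>\<epsilon>. 0 < \<epsilon> \<and> \<epsilon> < \<epsilon>0 \<longrightarrow>
              L2norm (\<lambda>x. slow (U t x (1 / \<epsilon>)) - w t x)
                \<le> C * exp t * \<epsilon> * \<bar>ln \<epsilon>\<bar> * sobolev_norm 2 U0)))"
proof -
  define L where "L \<xi> = flux_symbol (\<lambda>j. block11 (A j)) \<xi>" for \<xi>
  obtain K where K1: "K \<ge> 1"
    and KH: "\<And>\<xi> \<eta> t. \<eta> \<ge> 0 \<Longrightarrow> t \<ge> 0 \<Longrightarrow> onorm ((*v) (matexp (t *\<^sub>R H A Q \<xi> \<eta>))) \<le> K"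
    using assms(2) unfolding stiffly_well_posed_def by (rule uniformly_quasi_stable_bound) blast
  have KL: "onorm ((*v) (matexp (t *\<^sub>R L \<xi>))) \<le> K" if "t \<ge> 0" for t \<xi>
    unfolding L_def using onorm_reduced_le[OF assms(1) K1 KH that] .
  have nH: "norm (matexp (t *\<^sub>R H A Q \<xi> (1 / \<epsilon>)) *v v) \<le> K * norm v" if "t \<ge> 0" "\<epsilon> > 0" for t \<xi> \<epsilon> v
    by (rule order_trans[OF norm_matrix_vector_onorm]) (intro mult_right_mono KH, use that in auto)
  have nL: "norm (matexp (t *\<^sub>R L \<xi>) *v v) \<le> K * norm v" if "t \<ge> 0" for t \<xi> v
    by (rule order_trans[OF norm_matrix_vector_onorm]) (intro mult_right_mono KL, use that in auto)
  have hyp: "strongly_hyperbolic (\<lambda>j. block11 (A j))"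
    unfolding strongly_hyperbolic_def uniformly_quasi_stable_def bdd_above_def
    using KL by (auto simp: L_def)
  obtain c where c: "c \<ge> 0" "\<And>\<xi> \<epsilon> t K w. \<lbrakk>\<epsilon> > 0; t \<ge> 0; K \<ge> 1;
       \<And>s. s \<in> {0..t} \<Longrightarrow> norm (matexp (s *\<^sub>R H A Q \<xi> (1 / \<epsilon>)) *v w) \<le> K * norm w;
       \<And>s. s \<in> {0..t} \<Longrightarrow> onorm ((*v) (matexp (s *\<^sub>R flux_symbol (\<lambda>j. block11 (A j)) \<xi>))) \<le> K\<rbrakk> \<Longrightarrow>
     norm (slow (matexp (t *\<^sub>R H A Q \<xi> (1 / \<epsilon>)) *v w) -
        matexp (t *\<^sub>R flux_symbol (\<lambda>j. block11 (A j)) \<xi>) *v slow w)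
     \<le> c * \<epsilon> * K\<^sup>2 * (1 + t) * (1 + (norm \<xi>)\<^sup>2) * norm w"
    by (rule slow_matexp_relaxation_estimate[OF assms(1), of A]) blast
  define D where "D g t \<eta> \<xi> = slow (matexp (t *\<^sub>R H A Q \<xi> \<eta>) *v g \<xi>) - matexp (t *\<^sub>R L \<xi>) *v slow (g \<xi>)"
    for g :: "real^'d \<Rightarrow> complex^('m + 'r)" and t \<eta> \<xi>
  have D_meas: "D g t \<eta> \<in> borel_measurable borel" if "g \<in> borel_measurable borel" for g t \<eta>
    using borel_measurable_slow_defect[OF that] by (simp add: D_def[abs_def] L_def)
  have D_le: "norm (D g t (1 / \<epsilon>) \<xi>) \<le> (c * K\<^sup>2 * (1 + t) * ((1 + (norm \<xi>)\<^sup>2) * norm (g \<xi>))) * \<epsilon>"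
    if "t \<ge> 0" "\<epsilon> > 0" for g t \<epsilon> \<xi>
  proof -
    have "norm (D g t (1 / \<epsilon>) \<xi>) \<le> c * \<epsilon> * K\<^sup>2 * (1 + t) * (1 + (norm \<xi>)\<^sup>2) * norm (g \<xi>)"
      unfolding D_def L_def using that nH KL by (intro c(2) K1) (auto simp: L_def)
    then show ?thesis by (simp add: mult_ac)
  qed
  \<comment> \<open>This complements \<open>D_le\<close>: the bound there is small in
    \<open>\<epsilon>\<close> but grows with the frequency, while this one is uniform in the
    frequency without being small. The first gives pointwise convergence, the second the dominating
    function.\<close>
  have D_dom: "norm (D g t \<eta> \<xi>) \<le> 2 * K * norm (g \<xi>)" if "t \<ge> 0" "\<eta> > 0" for g t \<eta> \<xi>
  proof -
    have "norm (D g t \<eta> \<xi>) \<le> norm (slow (matexp (t *\<^sub>R H A Q \<xi> \<eta>) *v g \<xi>)) + norm (matexp (t *\<^sub>R L \<xi>) *v slow (g \<xi>))"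
      unfolding D_def by (rule norm_triangle_ineq4)
    also have "norm (slow (matexp (t *\<^sub>R H A Q \<xi> \<eta>) *v g \<xi>)) \<le> K * norm (g \<xi>)"
      using order_trans[OF norm_slow_le nH[of t "1 / \<eta>" \<xi> "g \<xi>"]] that by simp
    also have "norm (matexp (t *\<^sub>R L \<xi>) *v slow (g \<xi>)) \<le> K * norm (slow (g \<xi>))"
      by (rule nL[OF that(1)])
    also have "\<dots> \<le> K * norm (g \<xi>)" using K1 by (intro mult_left_mono norm_slow_le) auto
    finally show ?thesis by simp
  qed
  have defect: "L2norm (\<lambda>x. slow (U t x (1 / \<epsilon>)) - w t x) \<le> L2norm (D g t (1 / \<epsilon>))"
    if "has_L2_fourier U0 g" "fourier_solution (\<lambda>\<xi>. H A Q \<xi> (1 / \<epsilon>)) U0 (\<lambda>t x. U t x (1 / \<epsilon>))"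
      "fourier_solution (flux_symbol (\<lambda>j. block11 (A j))) (\<lambda>x. slow (U0 x)) w" "t \<ge> 0"
    for U0 g \<epsilon> U w t
    using L2norm_slow_diff_le[OF that] by (simp add: D_def[abs_def] L_def)
  have conv: "((\<lambda>\<epsilon>. L2norm (\<lambda>x. slow (U t x (1 / \<epsilon>)) - w t x)) \<longlongrightarrow> 0) (at_right 0)"
    if U: "\<forall>\<epsilon>>0. fourier_solution (\<lambda>\<xi>. H A Q \<xi> (1 / \<epsilon>)) U0 (\<lambda>t x. U t x (1 / \<epsilon>))"
      and w: "fourier_solution (flux_symbol (\<lambda>j. block11 (A j))) (\<lambda>x. slow (U0 x)) w" and t: "t > 0"
    for U0 U w t
  proof -
    \<comment> \<open>Any admissible \<open>\<epsilon>\<close> would do: each solution carries a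
      transform of \<open>U0\<close>, and the case \<open>\<epsilon> = 1\<close> supplies
      one.\<close>
    obtain g where g: "has_L2_fourier U0 g" using U[rule_format, of 1] by (auto simp: fourier_solution_def)
    then have [measurable]: "g \<in> borel_measurable borel" and g2: "integrable lborel (\<lambda>\<xi>. (norm (g \<xi>))\<^sup>2)"
      by (auto simp: has_L2_fourier_def square_integrable_def)
    note [measurable] = D_meas[of g]
    \<comment> \<open>Dominated convergence is applied in \<open>\<eta> = 1 / \<epsilon>\<close>
      along \<open>at_top\<close>; inversion then transports the limit to \<open>\<epsilon>\<close>
      at \<open>0\<close> from the right.\<close>
    have "((\<lambda>\<eta>. \<integral>\<xi>. (norm (D g t \<eta> \<xi>))\<^sup>2 \<partial>lborel) \<longlongrightarrow> (\<integral>\<xi>. 0 \<partial>(lborel :: (real^'d) measure))) at_top"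
    proof (rule integral_dominated_convergence_at_top[where w="\<lambda>\<xi>. (2 * K)\<^sup>2 * (norm (g \<xi>))\<^sup>2"])
      show "AE \<xi> in lborel. ((\<lambda>\<eta>. (norm (D g t \<eta> \<xi>))\<^sup>2) \<longlongrightarrow> 0) at_top"
      proof (rule AE_I2)
        fix \<xi>
        define B where "B = c * K\<^sup>2 * (1 + t) * ((1 + (norm \<xi>)\<^sup>2) * norm (g \<xi>))"
        have lim: "((\<lambda>\<eta>. B * inverse \<eta>) \<longlongrightarrow> B * 0) at_top"
          by (intro tendsto_mult tendsto_const tendsto_inverse_0_at_top filterlim_ident)
        have "((\<lambda>\<eta>. D g t \<eta> \<xi>) \<longlongrightarrow> 0) at_top"
        proof (rule Lim_null_comparison)
          show "\<forall>\<^sub>F \<eta> in at_top. norm (D g t \<eta> \<xi>) \<le> B * inverse \<eta>"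
            using eventually_gt_at_top[of 0]
            by eventually_elim (use D_le[of t "inverse _" g \<xi>] t in \<open>simp add: B_def inverse_eq_divide\<close>)
        qed (use lim in simp)
        then have "((\<lambda>\<eta>. (norm (D g t \<eta> \<xi>))\<^sup>2) \<longlongrightarrow> (norm (0 :: complex^'m))\<^sup>2) at_top"
          by (intro tendsto_power tendsto_norm)
        then show "((\<lambda>\<eta>. (norm (D g t \<eta> \<xi>))\<^sup>2) \<longlongrightarrow> 0) at_top" by simp
      qed
      show "\<forall>\<^sub>F \<eta> in at_top. AE \<xi> in lborel. norm ((norm (D g t \<eta> \<xi>))\<^sup>2) \<le> (2 * K)\<^sup>2 * (norm (g \<xi>))\<^sup>2"
        using eventually_gt_at_top[of 0]
      proof eventually_elim
        case (elim \<eta>)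
        have "(norm (D g t \<eta> \<xi>))\<^sup>2 \<le> (2 * K * norm (g \<xi>))\<^sup>2" for \<xi>
          using elim t by (intro power_mono D_dom) auto
        then show ?case by (simp add: power_mult_distrib)
      qed
    qed (use g2 in auto)
    then have "((\<lambda>\<eta>. L2norm (D g t \<eta>)) \<longlongrightarrow> sqrt 0) at_top"
      unfolding L2norm_def by (intro tendsto_real_sqrt) simp
    then have "((\<lambda>\<epsilon>. L2norm (D g t (inverse \<epsilon>))) \<longlongrightarrow> sqrt 0) (at_right 0)"
      by (rule filterlim_compose[OF _ filterlim_inverse_at_top_right])
    then have lim: "((\<lambda>\<epsilon>. L2norm (D g t (1 / \<epsilon>))) \<longlongrightarrow> 0) (at_right 0)"
      by (simp add: inverse_eq_divide)
    have "\<forall>\<^sub>F \<epsilon> in at_right 0. L2norm (\<lambda>x. slow (U t x (1 / \<epsilon>)) - w t x) \<le> L2norm (D g t (1 / \<epsilon>))"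
      using eventually_at_right_less[of 0] by eventually_elim (rule defect[OF g _ w], use U t in auto)
    then show ?thesis
      by (intro tendsto_sandwich[OF _ _ tendsto_const lim]) (auto simp: L2norm_def)
  qed
  have rate: "L2norm (\<lambda>x. slow (U t x (1 / \<epsilon>)) - w t x) \<le> (c * K\<^sup>2) * exp t * \<epsilon> * \<bar>ln \<epsilon>\<bar> * sobolev_norm 2 U0"
    if U0: "U0 \<in> sobolev_space 2"
      and U: "\<forall>\<epsilon>>0. fourier_solution (\<lambda>\<xi>. H A Q \<xi> (1 / \<epsilon>)) U0 (\<lambda>t x. U t x (1 / \<epsilon>))"
      and w: "fourier_solution (flux_symbol (\<lambda>j. block11 (A j))) (\<lambda>x. slow (U0 x)) w" and t: "t > 0"
      and \<epsilon>: "0 < \<epsilon>" "\<epsilon> < exp (- 1)"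
    for U0 U w t \<epsilon>
  proof -
    obtain g' where g': "has_L2_fourier U0 g'" "square_integrable (sobolev_weight 2 g')"
      using U0 by (auto simp: sobolev_space_def)
    define g where "g = L2_fourier U0"
    have g: "has_L2_fourier U0 g"
      unfolding g_def L2_fourier_def by (rule someI[of "has_L2_fourier U0"]) (rule g')
    then have [measurable]: "g \<in> borel_measurable borel"
      by (auto simp: has_L2_fourier_def square_integrable_def)
    \<comment> \<open>At order \<open>2\<close> the weight is exactly the factor
      \<open>1 + (norm \<xi>)^2\<close> of \<open>D_le\<close>.\<close>
    have sw: "sobolev_weight 2 h \<xi> = (1 + (norm \<xi>)\<^sup>2) *\<^sub>R h \<xi>" for h \<xi>
      by (simp add: sobolev_weight_def add_nonneg_nonneg)
    have [measurable]: "sobolev_weight 2 g \<in> borel_measurable borel"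
      unfolding sw[abs_def] by measurable
    \<comment> \<open>Membership in the Sobolev space speaks of some transform \<open>g'\<close>,
      the norm of the chosen one \<open>g\<close>. Integrability has to be carried over, since
      otherwise the Bochner integral in the norm could take its default value
      \<open>0\<close>.\<close>
    have "AE \<xi> in lborel. (norm (sobolev_weight 2 g' \<xi>))\<^sup>2 = (norm (sobolev_weight 2 g \<xi>))\<^sup>2"
      using has_L2_fourier_unique[OF g'(1) g] by eventually_elim (simp add: sw)
    then have s2: "integrable lborel (\<lambda>\<xi>. (norm (sobolev_weight 2 g \<xi>))\<^sup>2)"
      using g'(2) integrable_cong_AE_imp[of lborel "\<lambda>\<xi>. (norm (sobolev_weight 2 g' \<xi>))\<^sup>2" "\<lambda>\<xi>. (norm (sobolev_weight 2 g \<xi>))\<^sup>2"]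
      by (auto simp: square_integrable_def)
    define B where "B = c * K\<^sup>2 * (1 + t) * \<epsilon>"
    have "B \<ge> 0" using c t \<epsilon> by (simp add: B_def)
    have "norm (D g t (1 / \<epsilon>) \<xi>) \<le> B * norm (sobolev_weight 2 g \<xi>)" for \<xi>
      using D_le[of t \<epsilon> g \<xi>] t \<epsilon> by (simp add: B_def sw mult_ac add_nonneg_nonneg)
    then have pt: "(norm (D g t (1 / \<epsilon>) \<xi>))\<^sup>2 \<le> B\<^sup>2 * (norm (sobolev_weight 2 g \<xi>))\<^sup>2" for \<xi>
      by (metis norm_ge_zero power_mono power_mult_distrib)
    have "(\<integral>\<xi>. (norm (D g t (1 / \<epsilon>) \<xi>))\<^sup>2 \<partial>lborel) \<le> (\<integral>\<xi>. B\<^sup>2 * (norm (sobolev_weight 2 g \<xi>))\<^sup>2 \<partial>lborel)"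
      using s2 by (intro integral_mono' pt) auto
    also have "\<dots> = B\<^sup>2 * (\<integral>\<xi>. (norm (sobolev_weight 2 g \<xi>))\<^sup>2 \<partial>lborel)" by simp
    finally have "L2norm (D g t (1 / \<epsilon>)) \<le> sqrt (B\<^sup>2 * (\<integral>\<xi>. (norm (sobolev_weight 2 g \<xi>))\<^sup>2 \<partial>lborel))"
      unfolding L2norm_def by (rule real_sqrt_le_mono)
    also have "\<dots> = B * sobolev_norm 2 U0"
      using \<open>B \<ge> 0\<close> by (simp add: real_sqrt_mult sobolev_norm_def L2norm_def g_def)
    also have "\<dots> \<le> ((c * K\<^sup>2) * exp t * \<epsilon> * \<bar>ln \<epsilon>\<bar>) * sobolev_norm 2 U0"
    proof (rule mult_right_mono)
      \<comment> \<open>The threshold \<open>exp (- 1)\<close> makes the logarithmic factor at least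
        \<open>1\<close>; together with \<open>1 + t \<le> exp t\<close> this puts the bound of
        order \<open>\<epsilon> * (1 + t)\<close> into the required form.\<close>
      have "ln \<epsilon> < - 1" using \<epsilon> ln_less_cancel_iff[of \<epsilon> "exp (- 1)"] by simp
      then have "1 \<le> \<bar>ln \<epsilon>\<bar>" by simp
      then have "(1 + t) * 1 \<le> exp t * \<bar>ln \<epsilon>\<bar>"
        using exp_ge_add_one_self[of t] t by (intro mult_mono) auto
      then have "(c * K\<^sup>2 * \<epsilon>) * ((1 + t) * 1) \<le> (c * K\<^sup>2 * \<epsilon>) * (exp t * \<bar>ln \<epsilon>\<bar>)"
        using c \<epsilon> by (intro mult_left_mono) auto
      then show "B \<le> (c * K\<^sup>2) * exp t * \<epsilon> * \<bar>ln \<epsilon>\<bar>" by (simp add: B_def mult_ac)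
    qed (simp add: sobolev_norm_def L2norm_def)
    finally show ?thesis
      using defect[where U=U and t=t and \<epsilon>=\<epsilon>, OF g U[rule_format, OF \<epsilon>(1)] w] t by linarith
  qed
  show ?thesis
    using hyp conv rate by (intro conjI allI impI exI[of _ "c * K\<^sup>2"] exI[of _ "exp (- 1 :: real)"]) auto
qed

end
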